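(* Let $\theta$ be an inner function and let $\phi\in L^2$. The dual truncated Hankel operator $\mathcal{H}_\phi^\theta$ (densely defined on $K_\theta^\perp\cap L^\infty$) is bounded if and only if $\phi\in L^\infty$, and in that case $\|\mathcal{H}_\phi^\theta\|=\|\phi\|_\infty$. Moreover, the only compact dual truncated Hankel operator is the zero operator.
   Context: $\mathbb{T}$ is the unit circle with normalized Lebesgue measure, $L^2=L^2(\mathbb{T})$, $L^\infty=L^\infty(\mathbb{T})$. $H^2\subset L^2$ is the Hardy space (functions whose negative Fourier coefficients vanish), $H_0^2=zH^2$, $\overline{H_0^2}=L^2\ominus H^2$. $P:L^2\to H^2$ is the orthogonal projection and $Q=I-P$ is the orthogonal projection onto $\overline{H_0^2}$. The flip $J$ on $L^2$ is $(Jf)(z)=f(\bar z)$, $z\in\mathbb{T}$. For an inner function $\theta$ (bounded analytic on the disk, unimodular a.e. on $\mathbb{T}$), $K_\theta=H^2\ominus\theta H^2$ and $K_\theta^\perp=L^2\ominus K_\theta=\overline{H_0^2}\oplus\theta H^2$; $Q_\theta=Q+\theta P\bar\theta$ is the orthogonal projection of $L^2$ onto $K_\theta^\perp$. The dual truncated Hankel operator with symbol $\phi$ is $\mathcal{H}_\phi^\theta(h)=Q_\theta J(\phi h)$ with values in $K_\theta^\perp$; for $\phi\in L^\infty$ it is defined on all of $K_\theta^\perp$, and for $\phi\in L^2$ it is defined for $h\in K_\theta^\perp\cap L^\infty$. *)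

theory Defs
  imports "HOL-Analysis.Analysis" "HOL-Probability.Essential_Supremum"
begin

text \<open>
  Elements of \<open>L\<^sup>2\<close> and \<open>L\<^sup>\<infinity>\<close> of the unit circle are represented by Borel functions
  \<open>complex \<Rightarrow> complex\<close>, of which only the values on the unit circle matter, and these only up to
  null sets: all equalities between elements of \<open>L\<^sup>2\<close> are equalities almost everywhere.
\<close>

definition circle :: "complex measure" where
  "circle = distr (uniform_measure lborel {0..<2 * pi}) borel cis"

definition L2 :: "(complex \<Rightarrow> complex) set" where
  "L2 = {f \<in> borel_measurable circle. integrable circle (\<lambda>z. (cmod (f z))\<^sup>2)}"

definition l2_inner :: "(complex \<Rightarrow> complex) \<Rightarrow> (complex \<Rightarrow> complex) \<Rightarrow> complex" where
  "l2_inner f g = (\<integral>z. f z * cnj (g z) \<partial>circle)"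

definition l2_norm :: "(complex \<Rightarrow> complex) \<Rightarrow> real" where
  "l2_norm f = sqrt (\<integral>z. (cmod (f z))\<^sup>2 \<partial>circle)"

definition linf_norm :: "(complex \<Rightarrow> complex) \<Rightarrow> ennreal" where
  "linf_norm f = esssup circle (\<lambda>z. ennreal (cmod (f z)))"

definition Linf :: "(complex \<Rightarrow> complex) set" where
  "Linf = {f \<in> borel_measurable circle. linf_norm f < \<infinity>}"

definition l2_orth :: "(complex \<Rightarrow> complex) set \<Rightarrow> (complex \<Rightarrow> complex) set" where
  "l2_orth S = {f \<in> L2. \<forall>g\<in>S. l2_inner f g = 0}"

text \<open>
  A representative of the orthogonal projection of \<open>f\<close> onto the closed subspace \<open>S\<close> of \<open>L\<^sup>2\<close>;
  it is determined up to a null set.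
\<close>

definition l2_proj :: "(complex \<Rightarrow> complex) set \<Rightarrow> (complex \<Rightarrow> complex) \<Rightarrow> (complex \<Rightarrow> complex)" where
  "l2_proj S f = (SOME g. g \<in> S \<and> (\<lambda>z. f z - g z) \<in> l2_orth S)"

definition fourier_coeff :: "(complex \<Rightarrow> complex) \<Rightarrow> int \<Rightarrow> complex" where
  "fourier_coeff f n = (\<integral>z. f z * z powi (- n) \<partial>circle)"

definition H2 :: "(complex \<Rightarrow> complex) set" where
  "H2 = {f \<in> L2. \<forall>n<0. fourier_coeff f n = 0}"

definition hardy_proj :: "(complex \<Rightarrow> complex) \<Rightarrow> (complex \<Rightarrow> complex)" where
  "hardy_proj = l2_proj H2"

definition hardy_perp_proj :: "(complex \<Rightarrow> complex) \<Rightarrow> (complex \<Rightarrow> complex)" where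
  "hardy_perp_proj f = (\<lambda>z. f z - hardy_proj f z)"

definition flip :: "(complex \<Rightarrow> complex) \<Rightarrow> (complex \<Rightarrow> complex)" where
  "flip f = (\<lambda>z. f (cnj z))"

text \<open>
  An inner function is given as one function on the closed disk: the analytic function on the open
  disk, together with its boundary function on the circle, which is a.e. the radial limit.
  The measurability condition selects a Borel representative of the boundary function
  (the measure \<open>circle\<close> is not complete).
\<close>

definition inner_function :: "(complex \<Rightarrow> complex) \<Rightarrow> bool" where
  "inner_function \<theta> \<longleftrightarrow>
     \<theta> holomorphic_on ball 0 1 \<and> bounded (\<theta> ` ball 0 1) \<and>
     \<theta> \<in> borel_measurable circle \<and>
     (AE z in circle. ((\<lambda>r::real. \<theta> (of_real r * z)) \<longlongrightarrow> \<theta> z) (at_left 1)) \<and>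
     (AE z in circle. cmod (\<theta> z) = 1)"

definition model_space :: "(complex \<Rightarrow> complex) \<Rightarrow> (complex \<Rightarrow> complex) set" where
  "model_space \<theta> = H2 \<inter> l2_orth ((\<lambda>h z. \<theta> z * h z) ` H2)"

definition model_perp :: "(complex \<Rightarrow> complex) \<Rightarrow> (complex \<Rightarrow> complex) set" where
  "model_perp \<theta> = l2_orth (model_space \<theta>)"

definition model_perp_proj :: "(complex \<Rightarrow> complex) \<Rightarrow> (complex \<Rightarrow> complex) \<Rightarrow> (complex \<Rightarrow> complex)" where
  "model_perp_proj \<theta> f = (\<lambda>z. hardy_perp_proj f z + \<theta> z * hardy_proj (\<lambda>w. cnj (\<theta> w) * f w) z)"

definition dual_trunc_hankel ::
  "(complex \<Rightarrow> complex) \<Rightarrow> (complex \<Rightarrow> complex) \<Rightarrow> (complex \<Rightarrow> complex) \<Rightarrow> (complex \<Rightarrow> complex)" where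
  "dual_trunc_hankel \<theta> \<phi> h = model_perp_proj \<theta> (flip (\<lambda>z. \<phi> z * h z))"

text \<open>
  The following notions concern an operator \<open>T\<close> with an explicitly given domain
  \<open>D \<subseteq> L\<^sup>2\<close>, which need not be closed.
\<close>

definition l2_dense_in :: "(complex \<Rightarrow> complex) set \<Rightarrow> (complex \<Rightarrow> complex) set \<Rightarrow> bool" where
  "l2_dense_in D S \<longleftrightarrow>
     D \<subseteq> S \<and> (\<forall>f\<in>S. \<forall>\<epsilon>>0. \<exists>g\<in>D. l2_norm (\<lambda>z. f z - g z) < \<epsilon>)"

definition bounded_op ::
  "(complex \<Rightarrow> complex) set \<Rightarrow> ((complex \<Rightarrow> complex) \<Rightarrow> (complex \<Rightarrow> complex)) \<Rightarrow> bool" where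
  "bounded_op D T \<longleftrightarrow> (\<exists>C. \<forall>h\<in>D. l2_norm (T h) \<le> C * l2_norm h)"

definition op_norm ::
  "(complex \<Rightarrow> complex) set \<Rightarrow> ((complex \<Rightarrow> complex) \<Rightarrow> (complex \<Rightarrow> complex)) \<Rightarrow> ennreal" where
  "op_norm D T = (SUP h\<in>{h \<in> D. l2_norm h \<le> 1}. ennreal (l2_norm (T h)))"

definition compact_op ::
  "(complex \<Rightarrow> complex) set \<Rightarrow> ((complex \<Rightarrow> complex) \<Rightarrow> (complex \<Rightarrow> complex)) \<Rightarrow> bool" where
  "compact_op D T \<longleftrightarrow>
     (\<forall>h :: nat \<Rightarrow> complex \<Rightarrow> complex.
        (\<forall>n. h n \<in> D) \<and> (\<exists>C. \<forall>n. l2_norm (h n) \<le> C) \<longrightarrow>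
        (\<exists>g\<in>L2. \<exists>r. strict_mono r \<and>
           (\<lambda>n. l2_norm (\<lambda>z. T (h (r n)) z - g z)) \<longlonglongrightarrow> 0))"

definition zero_op ::
  "(complex \<Rightarrow> complex) set \<Rightarrow> ((complex \<Rightarrow> complex) \<Rightarrow> (complex \<Rightarrow> complex)) \<Rightarrow> bool" where
  "zero_op D T \<longleftrightarrow> (\<forall>h\<in>D. AE z in circle. T h z = 0)"

end

theory Submission
  imports Defs "HOL-Probability.Probability_Measure" "HOL-Complex_Analysis.Cauchy_Integral_Formula"
begin

text \<open>
  Write \<open>H\<close> for the operator. The upper bound \<open>\<parallel>H h\<parallel> \<le> \<parallel>\<phi>\<parallel>\<^sub>\<infinity> \<parallel>h\<parallel>\<close> holds because the flip is isometric and \<open>Q\<^sub>\<theta>\<close> is a contraction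
  (\<open>model_perp_proj_contraction\<close>).

  Everything else comes from one family of test functions, \<open>h\<^sub>n = cnj z ^ n * p\<close> with a trigonometric
  polynomial \<open>p\<close>. For large \<open>n\<close> they are bounded and orthogonal to \<open>H\<^sup>2\<close>, hence lie in every domain
  under consideration, and all have the norm of \<open>p\<close>. The flip turns the factor \<open>cnj z ^ n\<close> into \<open>z\<^sup>n\<close>, so that
  \<open>H h\<^sub>n = Q\<^sub>\<theta> (z\<^sup>n G)\<close> with \<open>G\<close> the flip of \<open>\<phi> p\<close>. Multiplication by \<open>z\<^sup>n\<close> pushes every fixed
  function into \<open>H\<^sup>2\<close> up to a small error. Applied to \<open>cnj \<theta> G\<close>, this shows that \<open>z\<^sup>n G\<close> is almost in \<open>\<theta> H\<^sup>2\<close>,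
  where \<open>Q\<^sub>\<theta>\<close> is the identity, so \<open>\<parallel>z\<^sup>n G - H h\<^sub>n\<parallel>\<close> tends to zero (\<open>hankel_shift\<close>).

  If \<open>H\<close> has norm at most \<open>C\<close>, then in the limit \<open>\<parallel>\<phi> p\<parallel> \<le> C \<parallel>p\<parallel>\<close> for every trigonometric polynomial \<open>p\<close>. By
  Weierstrass approximation the squares \<open>\<bar>p\<bar>\<^sup>2\<close> detect the sign of an integrable function
  (\<open>nonpos_AE_if_trig_integrals_nonpos\<close>), which gives \<open>\<bar>\<phi>\<bar> \<le> C\<close> almost everywhere. This yields
  the characterization of boundedness and the lower bound for the norm.

  If \<open>H\<close> is compact, take \<open>p = 1\<close>: a subsequence of \<open>H h\<^sub>n\<close>, and so of \<open>z\<^sup>n G\<close>, converges in norm. But \<open>z\<^sup>n G\<close>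
  tends weakly to zero and has constant norm \<open>\<parallel>\<phi>\<parallel>\<close>, so \<open>\<phi> = 0\<close>
  (\<open>hankel_compact_imp_symbol_zero\<close>).

  The Hilbert space tools are built on functions modulo null sets: completeness of \<open>L\<^sup>2\<close>, the
  projection theorem for closed subspaces, which provides \<open>P\<close>, and the description of \<open>H\<^sup>2\<close> and its
  complement by Fourier coefficients. Density of the bounded functions in \<open>K\<^sub>\<theta>\<^sup>\<bottom>\<close> follows by duality: what
  is orthogonal to them lies in \<open>K\<^sub>\<theta>\<close> (\<open>bounded_model_perp_dense\<close>).
\<close>

section \<open>The normalized Lebesgue measure of the circle\<close>

lemma sets_circle [measurable_cong, simp]: "sets circle = sets borel"
  by (simp add: circle_def)

lemma space_circle [simp]: "space circle = UNIV"
  by (simp add: circle_def)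

lemma borel_measurable_cis [measurable]: "cis \<in> borel_measurable borel"
  by (intro borel_measurable_continuous_onI continuous_intros)

lemma borel_measurable_cnj [measurable, simp]: "cnj \<in> borel_measurable borel"
  by (intro borel_measurable_continuous_onI continuous_intros)

lemma emeasure_lborel_period: "emeasure lborel {0..<2 * pi} = ennreal (2 * pi)"
  by simp

lemma prob_space_arc: "prob_space (uniform_measure lborel {0..<2 * pi})"
  by (rule prob_space_uniform_measure) (auto simp: emeasure_lborel_period)

interpretation circle: prob_space circle
  unfolding circle_def
  by (rule prob_space.prob_space_distr[OF prob_space_arc]) simp

lemma AE_circle_norm: "AE z in circle. cmod z = 1"
  unfolding circle_def by (subst AE_distr_iff) auto

lemma integral_circle:
  fixes f :: "complex \<Rightarrow> 'b::{banach, second_countable_topology}"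
  assumes [measurable]: "f \<in> borel_measurable borel"
  shows "(\<integral>z. f z \<partial>circle) = (1 / (2 * pi)) *\<^sub>R (\<integral>t. indicator {0..<2 * pi} t *\<^sub>R f (cis t) \<partial>lborel)"
proof -
  have "(\<integral>z. f z \<partial>circle) = (\<integral>t. f (cis t) \<partial>uniform_measure lborel {0..<2 * pi})"
    unfolding circle_def by (rule integral_distr) auto
  also have "uniform_measure lborel {0..<2 * pi} =
      density lborel (\<lambda>t. ennreal (indicator {0..<2 * pi} t / (2 * pi)))"
    unfolding uniform_measure_def emeasure_lborel_period
    by (intro density_cong) (auto split: split_indicator simp: divide_ennreal simp flip: ennreal_1)
  also have "(\<integral>t. f (cis t) \<partial>\<dots>) = (\<integral>t. (indicator {0..<2 * pi} t / (2 * pi)) *\<^sub>R f (cis t) \<partial>lborel)"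
    by (rule integral_density) auto
  also have "\<dots> = (\<integral>t. (1 / (2 * pi)) *\<^sub>R (indicator {0..<2 * pi} t *\<^sub>R f (cis t)) \<partial>lborel)"
    by simp
  finally show ?thesis by (simp only: integral_scaleR_right)
qed

lemma borel_measurable_powi [measurable]: "(\<lambda>z::complex. z powi k) \<in> borel_measurable borel"
  by (cases "k \<ge> 0") (simp_all add: power_int_def)

lemma integral_circle_powi: "(\<integral>z. z powi k \<partial>circle) = (if k = 0 then 1 else 0)"
proof (cases "k = 0")
  case True
  then show ?thesis using circle.prob_space by simp
next
  case False
  let ?F = "\<lambda>t. exp (\<i> * of_int k * of_real t) / (\<i> * of_int k) :: complex"
  have cis: "cis t powi k = exp (\<i> * of_int k * of_real t)" for t
    by (simp add: cis_conv_exp exp_power_int mult_ac)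
  have "(\<integral>t. indicator {0..<2 * pi} t *\<^sub>R (cis t powi k) \<partial>lborel) =
        (\<integral>t. indicator {0..2 * pi} t *\<^sub>R (cis t powi k) \<partial>lborel)"
    using AE_lborel_singleton[of "2 * pi"]
    by (intro integral_cong_AE) (auto split: split_indicator elim!: eventually_mono)
  also have "\<dots> = ?F (2 * pi) - ?F 0"
  proof (rule integral_FTC_Icc)
    fix t :: real
    have "(?F has_vector_derivative exp (\<i> * of_int k * of_real t)) (at t)"
      using False
      by (auto intro!: derivative_eq_intros has_vector_derivative_real_field)
    then show "(?F has_vector_derivative (cis t powi k)) (at t within {0..2 * pi})"
      unfolding cis by (rule has_vector_derivative_at_within)
  next
    show "continuous_on {0..2 * pi} (\<lambda>t. cis t powi k)"
      unfolding cis by (intro continuous_intros)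
  qed auto
  also have "\<dots> = 0"
    using exp_integer_2pi[of "of_int k"] by (simp add: mult_ac)
  finally show ?thesis using False by (simp add: integral_circle)
qed

text \<open>The substitution \<open>t \<mapsto> 2\<pi> - t\<close> preserves the arc up to its end points.\<close>

lemma distr_circle_cnj: "distr circle borel cnj = circle"
proof (rule measure_eqI)
  fix A :: "complex set" assume "A \<in> sets (distr circle borel cnj)"
  then have [measurable]: "A \<in> sets borel" by simp
  let ?U = "uniform_measure lborel {0..<2 * pi}"
  have S: "emeasure circle B = emeasure lborel ({0..<2 * pi} \<inter> cis -` B) / (2 * pi)"
    if [measurable]: "B \<in> sets borel" for B
    unfolding circle_def emeasure_lborel_period[symmetric]
    using measurable_sets[OF borel_measurable_cis that]
    by (subst emeasure_distr) auto
  have m1: "{0..<2 * pi} \<inter> cis -` cnj -` A \<in> sets lborel" 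
    using measurable_sets[OF borel_measurable_cis, of "cnj -` A"] measurable_sets[of cnj borel borel A] by auto
  have m2: "{0..<2 * pi} \<inter> cis -` A \<in> sets lborel"
    using measurable_sets[OF borel_measurable_cis, of A] by auto
  have "emeasure lborel ({0..<2 * pi} \<inter> cis -` cnj -` A) =
      (\<integral>\<^sup>+t. indicator ({0..<2 * pi} \<inter> cis -` cnj -` A) t \<partial>lborel)"
    using m1 by simp
  also have "\<dots> = (\<integral>\<^sup>+t. indicator ({0..<2 * pi} \<inter> cis -` cnj -` A) (2 * pi + (-1) * t) \<partial>lborel)"
    using m1 by (subst nn_integral_real_affine[of _ "-1" "2 * pi"]) auto
  also have "\<dots> = (\<integral>\<^sup>+t. indicator ({0..<2 * pi} \<inter> cis -` A) t \<partial>lborel)"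
  proof (rule nn_integral_cong_AE)
    have *: "cnj (cis (2 * pi - t)) = cis t" for t
      by (simp add: complex_eq_iff cos_diff sin_diff)
    show "AE t in lborel. indicator ({0..<2 * pi} \<inter> cis -` cnj -` A) (2 * pi + (-1) * t) =
        (indicator ({0..<2 * pi} \<inter> cis -` A) t :: ennreal)"
      using AE_lborel_singleton[of "0::real"] AE_lborel_singleton[of "2 * pi"]
      by eventually_elim (auto split: split_indicator simp: *)
  qed
  also have "\<dots> = emeasure lborel ({0..<2 * pi} \<inter> cis -` A)"
    using m2 by simp
  finally show "emeasure (distr circle borel cnj) A = emeasure circle A"
    using measurable_sets[of cnj borel borel A]
    by (simp add: emeasure_distr S)
qed simp

lemma integral_circle_cnj:
  fixes f :: "complex \<Rightarrow> 'b::{banach, second_countable_topology}"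
  assumes "f \<in> borel_measurable borel"
  shows "(\<integral>z. f (cnj z) \<partial>circle) = (\<integral>z. f z \<partial>circle)"
proof -
  have "(\<integral>z. f z \<partial>circle) = (\<integral>z. f z \<partial>distr circle borel cnj)"
    by (simp add: distr_circle_cnj)
  also have "\<dots> = (\<integral>z. f (cnj z) \<partial>circle)"
    by (rule integral_distr) (simp_all add: assms)
  finally show ?thesis by simp
qed

lemma integrable_circle_cnj:
  fixes f :: "complex \<Rightarrow> 'b::{banach, second_countable_topology}"
  assumes "f \<in> borel_measurable borel"
  shows "integrable circle (\<lambda>z. f (cnj z)) \<longleftrightarrow> integrable circle f"
proof -
  have "integrable circle f \<longleftrightarrow> integrable (distr circle borel cnj) f"
    by (simp add: distr_circle_cnj)
  also have "\<dots> \<longleftrightarrow> integrable circle (\<lambda>z. f (cnj z))"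
    by (rule integrable_distr_eq) (simp_all add: assms)
  finally show ?thesis by simp
qed

section \<open>Square-integrable functions\<close>

lemma L2_measurable [measurable_dest]: "f \<in> L2 \<Longrightarrow> f \<in> borel_measurable borel"
  by (simp add: L2_def cong: measurable_cong_sets)

lemma L2_integrable: "f \<in> L2 \<Longrightarrow> integrable circle (\<lambda>z. (cmod (f z))\<^sup>2)"
  by (simp add: L2_def)

lemma L2I:
  assumes "f \<in> borel_measurable borel" "integrable circle (\<lambda>z. (cmod (f z))\<^sup>2)"
  shows "f \<in> L2"
  using assms by (simp add: L2_def cong: measurable_cong_sets)

lemma L2_dominated:
  assumes [measurable]: "f \<in> borel_measurable borel"
    and "integrable circle g" "AE z in circle. (cmod (f z))\<^sup>2 \<le> g z"
  shows "f \<in> L2"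
  using assms(3) by (intro L2I assms(1) Bochner_Integration.integrable_bound[OF assms(2)])
    (auto elim!: eventually_mono)

lemma L2_mult_bounded:
  assumes f: "f \<in> L2" and [measurable]: "m \<in> borel_measurable borel"
    and "AE z in circle. cmod (m z) \<le> C"
  shows "(\<lambda>z. m z * f z) \<in> L2"
proof (rule L2_dominated)
  note [measurable] = L2_measurable[OF f]
  show "(\<lambda>z. m z * f z) \<in> borel_measurable borel" by measurable
  show "integrable circle (\<lambda>z. C\<^sup>2 * (cmod (f z))\<^sup>2)"
    by (intro integrable_mult_right L2_integrable f)
  show "AE z in circle. (cmod (m z * f z))\<^sup>2 \<le> C\<^sup>2 * (cmod (f z))\<^sup>2"
    using assms(3) by eventually_elim (auto simp: norm_mult power_mult_distrib intro!: mult_right_mono power_mono)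
qed

lemma L2_bounded:
  assumes "m \<in> borel_measurable borel" "AE z in circle. cmod (m z) \<le> C"
  shows "m \<in> L2"
proof -
  have "(\<lambda>z. 1) \<in> L2" by (intro L2I) auto
  from L2_mult_bounded[OF this assms] show ?thesis by simp
qed

lemma L2_scale: "f \<in> L2 \<Longrightarrow> (\<lambda>z. c * f z) \<in> L2"
  by (rule L2_mult_bounded[where C = "cmod c"]) auto

lemma L2_zero: "(\<lambda>z. 0) \<in> L2"
  by (rule L2_bounded[where C = 0]) auto

lemma L2_add:
  assumes "f \<in> L2" "g \<in> L2"
  shows "(\<lambda>z. f z + g z) \<in> L2"
proof (rule L2_dominated)
  note [measurable] = L2_measurable[OF assms(1)] L2_measurable[OF assms(2)]
  show "(\<lambda>z. f z + g z) \<in> borel_measurable borel" by measurable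
  show "integrable circle (\<lambda>z. 2 * (cmod (f z))\<^sup>2 + 2 * (cmod (g z))\<^sup>2)"
    using assms[THEN L2_integrable] by auto
  have "(cmod (f z + g z))\<^sup>2 \<le> 2 * (cmod (f z))\<^sup>2 + 2 * (cmod (g z))\<^sup>2" for z
  proof -
    have "(cmod (f z + g z))\<^sup>2 \<le> (cmod (f z) + cmod (g z))\<^sup>2"
      by (intro power_mono norm_triangle_ineq) auto
    also have "\<dots> \<le> 2 * (cmod (f z))\<^sup>2 + 2 * (cmod (g z))\<^sup>2"
      using sum_squares_bound[of "cmod (f z)" "cmod (g z)"] by (simp add: power2_sum)
    finally show ?thesis .
  qed
  then show "AE z in circle. (cmod (f z + g z))\<^sup>2 \<le> 2 * (cmod (f z))\<^sup>2 + 2 * (cmod (g z))\<^sup>2"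
    by simp
qed

lemma L2_diff: "f \<in> L2 \<Longrightarrow> g \<in> L2 \<Longrightarrow> (\<lambda>z. f z - g z) \<in> L2"
  using L2_add[of f "\<lambda>z. - 1 * g z"] L2_scale[of g "- 1"] by simp

lemma L2_cnj: "f \<in> L2 \<Longrightarrow> (\<lambda>z. cnj (f z)) \<in> L2"
  by (intro L2I) (auto dest: L2_integrable)

lemma L2_flip: "f \<in> L2 \<Longrightarrow> flip f \<in> L2"
  unfolding flip_def
  using integrable_circle_cnj[of "\<lambda>z. (cmod (f z))\<^sup>2"]
  by (intro L2I measurable_compose[OF borel_measurable_cnj]) (auto dest: L2_integrable L2_measurable)

lemma L2_integrable_abs_mult:
  assumes "f \<in> L2" "g \<in> L2"
  shows "integrable circle (\<lambda>z. cmod (f z) * cmod (g z))"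
proof (rule Bochner_Integration.integrable_bound)
  note [measurable] = L2_measurable[OF assms(1)] L2_measurable[OF assms(2)]
  show "integrable circle (\<lambda>z. (cmod (f z))\<^sup>2 + (cmod (g z))\<^sup>2)"
    using assms[THEN L2_integrable] by auto
  show "(\<lambda>z. cmod (f z) * cmod (g z)) \<in> borel_measurable circle" by measurable
  have "cmod (f z) * cmod (g z) \<le> (cmod (f z))\<^sup>2 + (cmod (g z))\<^sup>2" for z
    using sum_squares_bound[of "cmod (f z)" "cmod (g z)"]
      mult_nonneg_nonneg[OF norm_ge_zero[of "f z"] norm_ge_zero[of "g z"]] by linarith
  then show "AE z in circle. norm (cmod (f z) * cmod (g z)) \<le> norm ((cmod (f z))\<^sup>2 + (cmod (g z))\<^sup>2)"
    by simp
qed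

lemma L2_integrable_mult:
  assumes "f \<in> L2" "g \<in> L2"
  shows "integrable circle (\<lambda>z. f z * g z)"
proof (rule Bochner_Integration.integrable_bound[OF L2_integrable_abs_mult[OF assms]])
  note [measurable] = L2_measurable[OF assms(1)] L2_measurable[OF assms(2)]
  show "(\<lambda>z. f z * g z) \<in> borel_measurable circle" by measurable
qed (simp add: norm_mult)

lemma L2_integrable_inner: "f \<in> L2 \<Longrightarrow> g \<in> L2 \<Longrightarrow> integrable circle (\<lambda>z. f z * cnj (g z))"
  by (intro L2_integrable_mult L2_cnj)

lemma L2_integrable_1: "f \<in> L2 \<Longrightarrow> integrable circle f"
  using L2_integrable_mult[OF _ L2_bounded[of "\<lambda>_. 1" 1], of f] by simp

lemma l2_norm_nonneg [simp]: "0 \<le> l2_norm f"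
  by (simp add: l2_norm_def)

lemma l2_norm_sq: "(l2_norm f)\<^sup>2 = (\<integral>z. (cmod (f z))\<^sup>2 \<partial>circle)"
  by (simp add: l2_norm_def)

lemma l2_inner_self: "l2_inner f f = of_real ((l2_norm f)\<^sup>2)"
  unfolding l2_inner_def l2_norm_sq
  by (subst integral_complex_of_real[symmetric])
    (simp only: complex_norm_square)

lemma l2_inner_commute: "l2_inner g f = cnj (l2_inner f g)"
proof -
  have "cnj (l2_inner f g) = (\<integral>z. cnj (f z * cnj (g z)) \<partial>circle)"
    unfolding l2_inner_def by (rule Bochner_Integration.integral_cnj[symmetric])
  then show ?thesis by (simp add: l2_inner_def mult.commute)
qed

lemma l2_inner_add_left:
  "\<lbrakk>f \<in> L2; g \<in> L2; h \<in> L2\<rbrakk> \<Longrightarrow> l2_inner (\<lambda>z. f z + g z) h = l2_inner f h + l2_inner g h"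
  unfolding l2_inner_def by (simp add: distrib_right L2_integrable_inner)

lemma l2_inner_diff_left:
  "\<lbrakk>f \<in> L2; g \<in> L2; h \<in> L2\<rbrakk> \<Longrightarrow> l2_inner (\<lambda>z. f z - g z) h = l2_inner f h - l2_inner g h"
  unfolding l2_inner_def by (simp add: left_diff_distrib L2_integrable_inner)

lemma l2_inner_scale_left: "l2_inner (\<lambda>z. c * f z) h = c * l2_inner f h"
  unfolding l2_inner_def by (simp add: mult.assoc)

lemma l2_inner_zero_left [simp]: "l2_inner (\<lambda>z. 0) h = 0"
  by (simp add: l2_inner_def)

lemma l2_inner_add_right:
  "\<lbrakk>f \<in> L2; g \<in> L2; h \<in> L2\<rbrakk> \<Longrightarrow> l2_inner h (\<lambda>z. f z + g z) = l2_inner h f + l2_inner h g"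
  unfolding l2_inner_def by (simp add: distrib_left L2_integrable_inner)

lemma l2_inner_diff_right:
  "\<lbrakk>f \<in> L2; g \<in> L2; h \<in> L2\<rbrakk> \<Longrightarrow> l2_inner h (\<lambda>z. f z - g z) = l2_inner h f - l2_inner h g"
  unfolding l2_inner_def by (simp add: right_diff_distrib L2_integrable_inner)

lemma l2_inner_scale_right: "l2_inner h (\<lambda>z. c * f z) = cnj c * l2_inner h f"
  unfolding l2_inner_def by (simp add: mult.left_commute)

lemma l2_norm_AE_cong:
  assumes "AE z in circle. cmod (f z) = cmod (g z)"
    and [measurable]: "f \<in> borel_measurable borel" "g \<in> borel_measurable borel"
  shows "l2_norm f = l2_norm g"
  unfolding l2_norm_def using assms(1)
  by (auto intro!: integral_cong_AE elim!: eventually_mono)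

lemma l2_norm_eq_0_iff:
  assumes "f \<in> L2"
  shows "l2_norm f = 0 \<longleftrightarrow> (AE z in circle. f z = 0)"
  unfolding l2_norm_def using integral_nonneg_eq_0_iff_AE[OF L2_integrable[OF assms]] by simp

lemma l2_norm_mult_bounded:
  assumes f: "f \<in> L2" and m [measurable]: "m \<in> borel_measurable borel"
    and bd: "AE z in circle. cmod (m z) \<le> C" and "0 \<le> C"
  shows "l2_norm (\<lambda>z. m z * f z) \<le> C * l2_norm f"
proof (rule power2_le_imp_le)
  have "(\<integral>z. (cmod (m z * f z))\<^sup>2 \<partial>circle) \<le> (\<integral>z. C\<^sup>2 * (cmod (f z))\<^sup>2 \<partial>circle)"
  proof (rule integral_mono_AE)
    show "integrable circle (\<lambda>z. (cmod (m z * f z))\<^sup>2)"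
      by (rule L2_integrable[OF L2_mult_bounded[OF f m bd]])
    show "integrable circle (\<lambda>z. C\<^sup>2 * (cmod (f z))\<^sup>2)"
      by (intro integrable_mult_right L2_integrable f)
    show "AE z in circle. (cmod (m z * f z))\<^sup>2 \<le> C\<^sup>2 * (cmod (f z))\<^sup>2"
      using bd by eventually_elim (auto simp: norm_mult power_mult_distrib intro!: mult_right_mono power_mono)
  qed
  then show "(l2_norm (\<lambda>z. m z * f z))\<^sup>2 \<le> (C * l2_norm f)\<^sup>2"
    by (simp add: l2_norm_sq power_mult_distrib)
qed (use assms in simp)

lemma l2_norm_mult_unimodular:
  assumes "f \<in> borel_measurable borel" "m \<in> borel_measurable borel" "AE z in circle. cmod (m z) = 1"
  shows "l2_norm (\<lambda>z. m z * f z) = l2_norm f"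
proof (rule l2_norm_AE_cong)
  note [measurable] = assms(1,2)
  show "(\<lambda>z. m z * f z) \<in> borel_measurable borel" by measurable
  show "AE z in circle. cmod (m z * f z) = cmod (f z)"
    using assms(3) by eventually_elim (simp add: norm_mult)
qed fact

lemma l2_norm_flip:
  assumes "f \<in> borel_measurable borel" shows "l2_norm (flip f) = l2_norm f"
  unfolding l2_norm_def flip_def
  using integral_circle_cnj[of "\<lambda>z. (cmod (f z))\<^sup>2"] assms by simp

lemma l2_norm_scale: "l2_norm (\<lambda>z. c * f z) = cmod c * l2_norm f"
  by (simp add: l2_norm_def norm_mult power_mult_distrib real_sqrt_mult)

lemma l2_norm_minus_commute: "l2_norm (\<lambda>z. f z - g z) = l2_norm (\<lambda>z. g z - f z)"
  by (simp add: l2_norm_def norm_minus_commute)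

lemma l2_norm_add_sq:
  assumes "f \<in> L2" "g \<in> L2"
  shows "(l2_norm (\<lambda>z. f z + g z))\<^sup>2 = (l2_norm f)\<^sup>2 + (l2_norm g)\<^sup>2 + 2 * Re (l2_inner f g)"
proof -
  have "l2_inner (\<lambda>z. f z + g z) (\<lambda>z. f z + g z) =
      l2_inner f f + l2_inner g g + (l2_inner f g + cnj (l2_inner f g))"
    using assms by (simp add: l2_inner_add_left l2_inner_add_right L2_add l2_inner_commute[of g f])
  from arg_cong[OF this, of Re] show ?thesis by (simp add: l2_inner_self)
qed

lemma l2_norm_diff_sq:
  assumes "f \<in> L2" "g \<in> L2"
  shows "(l2_norm (\<lambda>z. f z - g z))\<^sup>2 = (l2_norm f)\<^sup>2 + (l2_norm g)\<^sup>2 - 2 * Re (l2_inner f g)"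
  using l2_norm_add_sq[OF assms(1) L2_scale[OF assms(2), of "- 1"]]
    l2_norm_scale[of "- 1" g] l2_inner_scale_right[of f "- 1" g] by simp

lemma l2_norm_Pythagoras:
  assumes "f \<in> L2" "g \<in> L2" "l2_inner f g = 0"
  shows "(l2_norm (\<lambda>z. f z + g z))\<^sup>2 = (l2_norm f)\<^sup>2 + (l2_norm g)\<^sup>2"
  using l2_norm_add_sq[OF assms(1,2)] assms(3) by simp

text \<open>
  Integrate \<open>2 |f g| \<le> (b / a) |f|\<^sup>2 + (a / b) |g|\<^sup>2\<close>, where \<open>a\<close> and \<open>b\<close> are the norms of \<open>f\<close> and \<open>g\<close>.
\<close>

lemma l2_Cauchy_Schwarz_abs:
  assumes "f \<in> L2" "g \<in> L2"
  shows "(\<integral>z. cmod (f z) * cmod (g z) \<partial>circle) \<le> l2_norm f * l2_norm g"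
proof (cases "l2_norm f = 0 \<or> l2_norm g = 0")
  case True
  then have "AE z in circle. f z = 0 \<or> g z = 0"
    using assms[THEN l2_norm_eq_0_iff] by (auto elim!: eventually_mono)
  then have "AE z in circle. cmod (f z) * cmod (g z) = 0"
    by eventually_elim auto
  then have "(\<integral>z. cmod (f z) * cmod (g z) \<partial>circle) = 0"
    by (rule integral_eq_zero_AE)
  then show ?thesis by simp
next
  case False
  let ?a = "l2_norm f" and ?b = "l2_norm g"
  have pos: "?a > 0" "?b > 0"
    using False l2_norm_nonneg[of f] l2_norm_nonneg[of g] by linarith+
  have "(\<integral>z. cmod (f z) * cmod (g z) \<partial>circle) \<le>
      (\<integral>z. ?b / (2 * ?a) * (cmod (f z))\<^sup>2 + ?a / (2 * ?b) * (cmod (g z))\<^sup>2 \<partial>circle)"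
  proof (rule integral_mono)
    show "integrable circle (\<lambda>z. cmod (f z) * cmod (g z))"
      by (rule L2_integrable_abs_mult[OF assms])
    show "integrable circle (\<lambda>z. ?b / (2 * ?a) * (cmod (f z))\<^sup>2 + ?a / (2 * ?b) * (cmod (g z))\<^sup>2)"
      by (intro Bochner_Integration.integrable_add integrable_mult_right assms[THEN L2_integrable])
    fix z
    have "0 \<le> (?b * cmod (f z) - ?a * cmod (g z))\<^sup>2 / (2 * ?a * ?b)"
      using pos by simp
    also have "\<dots> = ?b / (2 * ?a) * (cmod (f z))\<^sup>2 + ?a / (2 * ?b) * (cmod (g z))\<^sup>2 - cmod (f z) * cmod (g z)"
      using pos by (simp add: field_simps power2_eq_square)
    finally show "cmod (f z) * cmod (g z) \<le> ?b / (2 * ?a) * (cmod (f z))\<^sup>2 + ?a / (2 * ?b) * (cmod (g z))\<^sup>2"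
      by simp
  qed
  also have "\<dots> = ?b / (2 * ?a) * ?a\<^sup>2 + ?a / (2 * ?b) * ?b\<^sup>2"
    unfolding l2_norm_sq using assms[THEN L2_integrable]
    by (subst Bochner_Integration.integral_add) (auto simp del: times_divide_eq_left)
  also have "\<dots> = ?a * ?b"
    using pos by (simp add: field_simps power2_eq_square)
  finally show ?thesis .
qed

lemma l2_Cauchy_Schwarz:
  assumes "f \<in> L2" "g \<in> L2"
  shows "cmod (l2_inner f g) \<le> l2_norm f * l2_norm g"
proof -
  have "cmod (l2_inner f g) \<le> (\<integral>z. cmod (f z * cnj (g z)) \<partial>circle)"
    unfolding l2_inner_def by (rule integral_norm_bound)
  also have "\<dots> \<le> l2_norm f * l2_norm g"
    using l2_Cauchy_Schwarz_abs[OF assms] by (simp add: norm_mult)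
  finally show ?thesis .
qed

lemma l2_norm_triangle:
  assumes "f \<in> L2" "g \<in> L2"
  shows "l2_norm (\<lambda>z. f z + g z) \<le> l2_norm f + l2_norm g"
proof (rule power2_le_imp_le)
  have "Re (l2_inner f g) \<le> l2_norm f * l2_norm g"
    using l2_Cauchy_Schwarz[OF assms] complex_Re_le_cmod[of "l2_inner f g"] by linarith
  then show "(l2_norm (\<lambda>z. f z + g z))\<^sup>2 \<le> (l2_norm f + l2_norm g)\<^sup>2"
    by (simp add: l2_norm_add_sq[OF assms] power2_sum)
qed simp

lemma l2_norm_triangle_diff:
  assumes "f \<in> L2" "g \<in> L2" "h \<in> L2"
  shows "l2_norm (\<lambda>z. f z - h z) \<le> l2_norm (\<lambda>z. f z - g z) + l2_norm (\<lambda>z. g z - h z)"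
  using l2_norm_triangle[OF L2_diff[OF assms(1,2)] L2_diff[OF assms(2,3)]] by simp

lemma l2_norm_triangle_sub:
  assumes "f \<in> L2" "g \<in> L2"
  shows "l2_norm f \<le> l2_norm g + l2_norm (\<lambda>z. f z - g z)"
  using l2_norm_triangle[OF assms(2) L2_diff[OF assms]] by simp

section \<open>Completeness and orthogonal projections\<close>

text \<open>
  A Cauchy sequence in \<open>L\<^sup>2\<close> is Cauchy in \<open>L\<^sup>1\<close>, since the measure is finite, and so has a subsequence
  that converges almost everywhere. Fatou's lemma shows that the pointwise limit is the limit in \<open>L\<^sup>2\<close>.
\<close>

lemma L2_complete:
  assumes s: "\<And>n. s n \<in> L2"
    and cauchy: "\<And>e. e > 0 \<Longrightarrow> \<exists>N. \<forall>i\<ge>N. \<forall>j\<ge>N. l2_norm (\<lambda>z. s i z - s j z) < e"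
  obtains g where "g \<in> L2" "(\<lambda>n. l2_norm (\<lambda>z. s n z - g z)) \<longlonglongrightarrow> 0"
proof -
  note [measurable] = L2_measurable[OF s]
  have one: "(\<lambda>z. 1) \<in> L2" by (rule L2_bounded[where C = 1]) auto
  have l1: "(\<integral>z. norm (s i z - s j z) \<partial>circle) \<le> l2_norm (\<lambda>z. s i z - s j z)" for i j
    using l2_Cauchy_Schwarz_abs[OF L2_diff[OF s s] one, of i j]
    using circle.prob_space by (simp add: l2_norm_def)
  have "\<exists>N. \<forall>i\<ge>N. \<forall>j\<ge>N. (\<integral>z. norm (s i z - s j z) \<partial>circle) < e" if "e > 0" for e
    using cauchy[OF that] l1 by (meson le_less_trans)
  then obtain r where r: "strict_mono r" and ae: "AE z in circle. Cauchy (\<lambda>i. s (r i) z)"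
    using cauchy_L1_AE_cauchy_subseq[of circle s] L2_integrable_1[OF s] by blast
  define g where "g z = lim (\<lambda>i. s (r i) z)" for z
  have g_meas [measurable]: "g \<in> borel_measurable borel"
    unfolding g_def by measurable
  have conv: "AE z in circle. (\<lambda>i. s (r i) z) \<longlonglongrightarrow> g z"
    using ae by eventually_elim (simp add: g_def Cauchy_convergent_iff convergent_LIMSEQ_iff)
  have *: "(\<lambda>z. s n z - g z) \<in> L2 \<and> l2_norm (\<lambda>z. s n z - g z) \<le> e"
    if "e > 0" and N: "\<forall>i\<ge>N. \<forall>j\<ge>N. l2_norm (\<lambda>z. s i z - s j z) < e" and "n \<ge> N" for n N e
  proof -
    have "(\<integral>\<^sup>+z. ennreal ((cmod (s n z - g z))\<^sup>2) \<partial>circle) =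
        (\<integral>\<^sup>+z. liminf (\<lambda>i. ennreal ((cmod (s n z - s (r i) z))\<^sup>2)) \<partial>circle)"
    proof (rule nn_integral_cong_AE)
      show "AE z in circle. ennreal ((cmod (s n z - g z))\<^sup>2) = liminf (\<lambda>i. ennreal ((cmod (s n z - s (r i) z))\<^sup>2))"
        using conv
      proof eventually_elim
        fix z assume "(\<lambda>i. s (r i) z) \<longlonglongrightarrow> g z"
        then have "(\<lambda>i. ennreal ((cmod (s n z - s (r i) z))\<^sup>2)) \<longlonglongrightarrow> ennreal ((cmod (s n z - g z))\<^sup>2)"
          by (intro tendsto_intros)
        from lim_imp_Liminf[OF trivial_limit_sequentially this]
        show "ennreal ((cmod (s n z - g z))\<^sup>2) = liminf (\<lambda>i. ennreal ((cmod (s n z - s (r i) z))\<^sup>2))"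
          by (rule sym)
      qed
    qed
    also have "\<dots> \<le> liminf (\<lambda>i. \<integral>\<^sup>+z. ennreal ((cmod (s n z - s (r i) z))\<^sup>2) \<partial>circle)"
      by (rule nn_integral_liminf) measurable
    also have "\<dots> \<le> ennreal (e\<^sup>2)"
    proof (rule Liminf_le)
      show "\<forall>\<^sub>F i in sequentially. (\<integral>\<^sup>+z. ennreal ((cmod (s n z - s (r i) z))\<^sup>2) \<partial>circle) \<le> ennreal (e\<^sup>2)"
        using eventually_ge_at_top[of N]
      proof eventually_elim
        fix i assume "N \<le> i"
        then have "N \<le> r i" using seq_suble[OF r, of i] by linarith
        then have "(l2_norm (\<lambda>z. s n z - s (r i) z))\<^sup>2 \<le> e\<^sup>2"
          using N \<open>n \<ge> N\<close> by (intro power_mono) (auto intro: less_imp_le)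
        then show "(\<integral>\<^sup>+z. ennreal ((cmod (s n z - s (r i) z))\<^sup>2) \<partial>circle) \<le> ennreal (e\<^sup>2)"
          using L2_integrable[OF L2_diff[OF s s], of n "r i"]
          by (subst nn_integral_eq_integral) (auto simp: l2_norm_sq intro!: ennreal_leI)
      qed
    qed simp
    finally have le: "(\<integral>\<^sup>+z. ennreal ((cmod (s n z - g z))\<^sup>2) \<partial>circle) \<le> ennreal (e\<^sup>2)" .
    have int: "integrable circle (\<lambda>z. (cmod (s n z - g z))\<^sup>2)"
      using le_less_trans[OF le, of \<infinity>] by (intro integrableI_nonneg) auto
    have "(l2_norm (\<lambda>z. s n z - g z))\<^sup>2 \<le> e\<^sup>2"
      using le int by (subst (asm) nn_integral_eq_integral) (auto simp: l2_norm_sq)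
    then have "l2_norm (\<lambda>z. s n z - g z) \<le> e"
      using \<open>e > 0\<close> by (rule power2_le_imp_le[OF _ less_imp_le])
    with int show ?thesis by (auto intro!: L2I)
  qed
  show thesis
  proof (rule that[of g])
    obtain N where "\<forall>i\<ge>N. \<forall>j\<ge>N. l2_norm (\<lambda>z. s i z - s j z) < 1"
      using cauchy[of 1] by auto
    then have "(\<lambda>z. s N z - g z) \<in> L2" using *[of 1 N N] by auto
    from L2_diff[OF s[of N] this] show "g \<in> L2" by simp
    show "(\<lambda>n. l2_norm (\<lambda>z. s n z - g z)) \<longlonglongrightarrow> 0"
    proof (rule LIMSEQ_I)
      fix e :: real assume "e > 0"
      then obtain N where "\<forall>i\<ge>N. \<forall>j\<ge>N. l2_norm (\<lambda>z. s i z - s j z) < e / 2"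
        using cauchy[of "e / 2"] by auto
      from *[OF _ this] have le: "l2_norm (\<lambda>z. s n z - g z) \<le> e / 2" if "n \<ge> N" for n
        using \<open>e > 0\<close> that by simp
      have "norm (l2_norm (\<lambda>z. s n z - g z) - 0) < e" if "n \<ge> N" for n
        using le[OF that] \<open>e > 0\<close> by simp
      then show "\<exists>N. \<forall>n\<ge>N. norm (l2_norm (\<lambda>z. s n z - g z) - 0) < e"
        by blast
    qed
  qed
qed

lemma l2_inner_tendsto:
  assumes s: "\<And>n. s n \<in> L2" and g: "g \<in> L2" and h: "h \<in> L2"
    and lim: "(\<lambda>n. l2_norm (\<lambda>z. s n z - g z)) \<longlonglongrightarrow> 0"
  shows "(\<lambda>n. l2_inner (s n) h) \<longlonglongrightarrow> l2_inner g h"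
proof (rule Lim_null_comparison[THEN LIM_zero_cancel])
  show "\<forall>\<^sub>F n in sequentially. norm (l2_inner (s n) h - l2_inner g h) \<le> l2_norm (\<lambda>z. s n z - g z) * l2_norm h"
    using l2_Cauchy_Schwarz[OF L2_diff[OF s g] h] by (simp add: l2_inner_diff_left s g h)
  show "(\<lambda>n. l2_norm (\<lambda>z. s n z - g z) * l2_norm h) \<longlonglongrightarrow> 0"
    by (rule tendsto_mult_left_zero[OF lim])
qed

definition l2_subspace :: "(complex \<Rightarrow> complex) set \<Rightarrow> bool" where
  "l2_subspace S \<longleftrightarrow> S \<subseteq> L2 \<and> (\<lambda>z. 0) \<in> S \<and> (\<forall>f\<in>S. \<forall>g\<in>S. (\<lambda>z. f z + g z) \<in> S) \<and>
     (\<forall>c. \<forall>f\<in>S. (\<lambda>z. c * f z) \<in> S)"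

definition l2_closure :: "(complex \<Rightarrow> complex) set \<Rightarrow> (complex \<Rightarrow> complex) set" where
  "l2_closure S = {f \<in> L2. \<forall>\<epsilon>>0. \<exists>g\<in>S. l2_norm (\<lambda>z. f z - g z) < \<epsilon>}"

lemma l2_subspaceD:
  assumes "l2_subspace S"
  shows "\<And>f. f \<in> S \<Longrightarrow> f \<in> L2" "(\<lambda>z. 0) \<in> S"
    "\<And>f g. f \<in> S \<Longrightarrow> g \<in> S \<Longrightarrow> (\<lambda>z. f z + g z) \<in> S"
    "\<And>c f. f \<in> S \<Longrightarrow> (\<lambda>z. c * f z) \<in> S"
  using assms unfolding l2_subspace_def by blast+

lemma l2_closureD: "f \<in> l2_closure S \<Longrightarrow> f \<in> L2"
  by (simp add: l2_closure_def)

lemma l2_closure_incl: "S \<subseteq> L2 \<Longrightarrow> S \<subseteq> l2_closure S"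
  unfolding l2_closure_def by (auto intro!: bexI simp: l2_norm_def)

lemma l2_closure_idem:
  assumes "S \<subseteq> L2"
  shows "l2_closure (l2_closure S) \<subseteq> l2_closure S"
proof
  fix f assume f: "f \<in> l2_closure (l2_closure S)"
  have "\<exists>h\<in>S. l2_norm (\<lambda>z. f z - h z) < \<epsilon>" if "\<epsilon> > 0" for \<epsilon>
  proof -
    obtain g where g: "g \<in> l2_closure S" "l2_norm (\<lambda>z. f z - g z) < \<epsilon> / 2"
      using f \<open>\<epsilon> > 0\<close> unfolding l2_closure_def[of "l2_closure S"] by (auto dest: spec[of _ "\<epsilon> / 2"])
    obtain h where h: "h \<in> S" "l2_norm (\<lambda>z. g z - h z) < \<epsilon> / 2"
      using g(1) \<open>\<epsilon> > 0\<close> unfolding l2_closure_def by (auto dest: spec[of _ "\<epsilon> / 2"])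
    have "l2_norm (\<lambda>z. f z - h z) \<le> l2_norm (\<lambda>z. f z - g z) + l2_norm (\<lambda>z. g z - h z)"
      using f g h assms by (intro l2_norm_triangle_diff) (auto dest: l2_closureD)
    with g h show ?thesis by (intro bexI[of _ h]) auto
  qed
  with f show "f \<in> l2_closure S"
    by (simp add: l2_closure_def)
qed

lemma l2_subspace_closure:
  assumes S: "l2_subspace S"
  shows "l2_subspace (l2_closure S)"
proof -
  note D = l2_subspaceD[OF S]
  have "(\<lambda>z. f z + g z) \<in> l2_closure S" if f: "f \<in> l2_closure S" and g: "g \<in> l2_closure S" for f g
    unfolding l2_closure_def
  proof (intro CollectI conjI allI impI)
    show "(\<lambda>z. f z + g z) \<in> L2" using f g by (intro L2_add) (auto dest: l2_closureD)
    fix \<epsilon> :: real assume "\<epsilon> > 0"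
    obtain a where a: "a \<in> S" "l2_norm (\<lambda>z. f z - a z) < \<epsilon> / 2"
      using f \<open>\<epsilon> > 0\<close> unfolding l2_closure_def by (auto dest: spec[of _ "\<epsilon> / 2"])
    obtain b where b: "b \<in> S" "l2_norm (\<lambda>z. g z - b z) < \<epsilon> / 2"
      using g \<open>\<epsilon> > 0\<close> unfolding l2_closure_def by (auto dest: spec[of _ "\<epsilon> / 2"])
    have "l2_norm (\<lambda>z. (f z - a z) + (g z - b z)) \<le> l2_norm (\<lambda>z. f z - a z) + l2_norm (\<lambda>z. g z - b z)"
      using f g a b D by (intro l2_norm_triangle L2_diff) (auto dest: l2_closureD)
    with a b show "\<exists>h\<in>S. l2_norm (\<lambda>z. f z + g z - h z) < \<epsilon>"
      by (intro bexI[of _ "\<lambda>z. a z + b z"]) (auto simp: algebra_simps D)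
  qed
  moreover have "(\<lambda>z. c * f z) \<in> l2_closure S" if f: "f \<in> l2_closure S" for c f
    unfolding l2_closure_def
  proof (intro CollectI conjI allI impI)
    show "(\<lambda>z. c * f z) \<in> L2" using f by (intro L2_scale) (auto dest: l2_closureD)
    fix \<epsilon> :: real assume "\<epsilon> > 0"
    have pos: "\<epsilon> / (cmod c + 1) > 0" using \<open>\<epsilon> > 0\<close> by (simp add: add_nonneg_pos)
    then obtain a where a: "a \<in> S" "l2_norm (\<lambda>z. f z - a z) < \<epsilon> / (cmod c + 1)"
      using f unfolding l2_closure_def by blast
    have "l2_norm (\<lambda>z. c * f z - c * a z) = cmod c * l2_norm (\<lambda>z. f z - a z)"
      by (simp add: l2_norm_scale flip: right_diff_distrib)
    also have "\<dots> \<le> (cmod c + 1) * l2_norm (\<lambda>z. f z - a z)"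
      by (intro mult_right_mono) auto
    also have "\<dots> < (cmod c + 1) * (\<epsilon> / (cmod c + 1))"
      using a(2) by (intro mult_strict_left_mono) (auto simp: add_nonneg_pos)
    also have "\<dots> = \<epsilon>"
      using norm_ge_zero[of c] by (simp add: add_nonneg_eq_0_iff)
    finally show "\<exists>h\<in>S. l2_norm (\<lambda>z. c * f z - h z) < \<epsilon>"
      using a(1) D(4) by (intro bexI[of _ "\<lambda>z. c * a z"]) auto
  qed
  moreover have "(\<lambda>z. 0) \<in> l2_closure S"
    using l2_closure_incl[of S] D by auto
  ultimately show ?thesis
    unfolding l2_subspace_def by (auto dest: l2_closureD)
qed

text \<open>
  A minimizing sequence for the distance from \<open>f\<close> to \<open>S\<close> is Cauchy by the parallelogram law; its limit \<open>g\<close> attains the distance, and comparing \<open>g\<close> with \<open>g + t h\<close> shows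
  that \<open>f - g\<close> is orthogonal to every \<open>h\<close> in \<open>S\<close>.
\<close>

lemma l2_projection_exists:
  assumes S: "l2_subspace S" and closed: "l2_closure S \<subseteq> S" and f: "f \<in> L2"
  obtains g where "g \<in> S" "(\<lambda>z. f z - g z) \<in> l2_orth S"
proof -
  note D = l2_subspaceD[OF S]
  define d where "d = (INF g\<in>S. (l2_norm (\<lambda>z. f z - g z))\<^sup>2)"
  have bdd: "bdd_below ((\<lambda>g. (l2_norm (\<lambda>z. f z - g z))\<^sup>2) ` S)"
    by (intro bdd_belowI[of _ 0]) auto
  have d_le: "d \<le> (l2_norm (\<lambda>z. f z - g z))\<^sup>2" if "g \<in> S" for g
    unfolding d_def by (rule cINF_lower[OF bdd that])
  have "\<exists>g\<in>S. (l2_norm (\<lambda>z. f z - g z))\<^sup>2 < d + 1 / real (Suc n)" for n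
    using cINF_less_iff[OF _ bdd, of "d + 1 / real (Suc n)"] D(2)
    by (auto simp: d_def[symmetric])
  then obtain s where s: "\<And>n. s n \<in> S"
    and s_lt: "\<And>n. (l2_norm (\<lambda>z. f z - s n z))\<^sup>2 < d + 1 / real (Suc n)"
    by metis
  have sL2: "s n \<in> L2" for n using s D by auto
  have near: "(l2_norm (\<lambda>z. s i z - s j z))\<^sup>2 \<le> 2 / real (Suc i) + 2 / real (Suc j)" for i j
  proof -
    let ?u = "\<lambda>z. f z - s i z" and ?v = "\<lambda>z. f z - s j z"
    have uv: "?u \<in> L2" "?v \<in> L2" using f sL2 by (auto intro: L2_diff)
    let ?m = "\<lambda>z. (1/2) * (s i z + s j z)"
    have m: "?m \<in> S" using D(4)[OF D(3)[OF s s]] .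
    have "(\<lambda>z. ?u z + ?v z) = (\<lambda>z. 2 * (f z - ?m z))" by (auto simp: algebra_simps)
    then have "(l2_norm (\<lambda>z. ?u z + ?v z))\<^sup>2 = 4 * (l2_norm (\<lambda>z. f z - ?m z))\<^sup>2"
      by (simp only: l2_norm_scale) (simp add: power_mult_distrib)
    moreover have "(l2_norm (\<lambda>z. ?u z - ?v z))\<^sup>2 = (l2_norm (\<lambda>z. s i z - s j z))\<^sup>2"
      using l2_norm_minus_commute[of "s i" "s j"] by simp
    ultimately show ?thesis
      using l2_norm_add_sq[OF uv] l2_norm_diff_sq[OF uv] d_le[OF m] s_lt[of i] s_lt[of j] by simp
  qed
  have "\<exists>N. \<forall>i\<ge>N. \<forall>j\<ge>N. l2_norm (\<lambda>z. s i z - s j z) < e" if "e > 0" for e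
  proof -
    obtain N where N: "1 / real (Suc N) < e\<^sup>2 / 4"
      using nat_approx_posE[of "e\<^sup>2 / 4"] \<open>e > 0\<close> by auto
    have "l2_norm (\<lambda>z. s i z - s j z) < e" if "i \<ge> N" "j \<ge> N" for i j
    proof (rule power2_less_imp_less)
      have "1 / real (Suc i) \<le> 1 / real (Suc N)" "1 / real (Suc j) \<le> 1 / real (Suc N)"
        using that by (auto intro!: divide_left_mono)
      with near[of i j] N show "(l2_norm (\<lambda>z. s i z - s j z))\<^sup>2 < e\<^sup>2" by simp
    qed (use \<open>e > 0\<close> in simp)
    then show ?thesis by blast
  qed
  from L2_complete[OF sL2 this] obtain g
    where g: "g \<in> L2" and lim: "(\<lambda>n. l2_norm (\<lambda>z. s n z - g z)) \<longlonglongrightarrow> 0" by blast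
  have "g \<in> l2_closure S"
    unfolding l2_closure_def
  proof (intro CollectI conjI g allI impI)
    fix \<epsilon> :: real assume "\<epsilon> > 0"
    from order_tendstoD(2)[OF lim this] obtain n where "l2_norm (\<lambda>z. s n z - g z) < \<epsilon>"
      by (auto dest: eventually_happens)
    then show "\<exists>h\<in>S. l2_norm (\<lambda>z. g z - h z) < \<epsilon>"
      by (intro bexI[OF _ s[of n]]) (simp add: l2_norm_minus_commute[of g "s n"])
  qed
  with closed have gS: "g \<in> S" by auto
  let ?w = "\<lambda>z. f z - g z"
  have w: "?w \<in> L2" by (rule L2_diff[OF f g])
  have "d \<ge> 0" unfolding d_def using D(2) by (intro cINF_greatest) auto
  have "l2_norm ?w \<le> sqrt d"
  proof (rule LIMSEQ_le_const)
    have "(\<lambda>n. sqrt (d + 1 / real (Suc n)) + l2_norm (\<lambda>z. s n z - g z)) \<longlonglongrightarrow> sqrt (d + 0) + 0"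
      by (intro tendsto_intros lim LIMSEQ_Suc[OF lim_1_over_n])
    then show "(\<lambda>n. sqrt (d + 1 / real (Suc n)) + l2_norm (\<lambda>z. s n z - g z)) \<longlonglongrightarrow> sqrt d" by simp
    show "\<exists>N. \<forall>n\<ge>N. l2_norm ?w \<le> sqrt (d + 1 / real (Suc n)) + l2_norm (\<lambda>z. s n z - g z)"
    proof (intro exI[of _ 0] allI impI)
      fix n
      have "l2_norm (\<lambda>z. f z - s n z) \<le> sqrt (d + 1 / real (Suc n))"
        using s_lt[of n] by (intro real_le_rsqrt) auto
      then show "l2_norm ?w \<le> sqrt (d + 1 / real (Suc n)) + l2_norm (\<lambda>z. s n z - g z)"
        using l2_norm_triangle_diff[OF f sL2 g, of n] by linarith
    qed
  qed
  then have w_le: "(l2_norm ?w)\<^sup>2 \<le> d"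
    using power_mono[of "l2_norm ?w" "sqrt d" 2] \<open>d \<ge> 0\<close> by simp
  have "l2_inner ?w h = 0" if h: "h \<in> S" for h
  proof (cases "l2_norm h = 0")
    case True
    then show ?thesis using l2_Cauchy_Schwarz[OF w D(1)[OF h]] by simp
  next
    case False
    define c where "c = l2_inner ?w h"
    define t where "t = c / of_real ((l2_norm h)\<^sup>2)"
    have th: "(\<lambda>z. t * h z) \<in> S" using D h by auto
    have "(\<lambda>z. g z + t * h z) \<in> S" using D(3)[OF gS th] .
    from d_le[OF this] have "d \<le> (l2_norm (\<lambda>z. ?w z - t * h z))\<^sup>2" by (simp add: algebra_simps)
    also have "\<dots> = (l2_norm ?w)\<^sup>2 + (cmod t)\<^sup>2 * (l2_norm h)\<^sup>2 - 2 * Re (cnj t * c)"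
      using l2_norm_diff_sq[OF w D(1)[OF th]]
      by (simp add: l2_norm_scale l2_inner_scale_right c_def power_mult_distrib)
    also have "cnj t * c = of_real ((cmod c)\<^sup>2 / (l2_norm h)\<^sup>2)"
      by (simp add: t_def mult.commute[of "cnj c" c] complex_norm_square[symmetric])
    also have "(cmod t)\<^sup>2 * (l2_norm h)\<^sup>2 = (cmod c)\<^sup>2 / (l2_norm h)\<^sup>2"
      using False by (simp add: t_def norm_divide norm_power norm_mult power_divide field_simps power2_eq_square)
    finally have "(cmod c)\<^sup>2 / (l2_norm h)\<^sup>2 \<le> 0" using w_le by simp
    moreover have "(cmod c)\<^sup>2 / (l2_norm h)\<^sup>2 \<ge> 0" by simp
    ultimately have "(cmod c)\<^sup>2 / (l2_norm h)\<^sup>2 = 0" by linarith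
    then show ?thesis using False by (simp add: c_def)
  qed
  with gS w show thesis by (intro that[of g]) (auto simp: l2_orth_def)
qed

text \<open>
  The error of the best approximation of \<open>f\<close> from the closure of \<open>S\<close> is orthogonal to that closure, by
  hypothesis also to \<open>f\<close>, and so to itself.
\<close>

lemma l2_bipolar:
  assumes S: "l2_subspace S" and f: "f \<in> L2"
    and "\<And>w. w \<in> l2_orth S \<Longrightarrow> l2_inner f w = 0"
  shows "f \<in> l2_closure S"
proof -
  have "S \<subseteq> L2" using S by (simp add: l2_subspace_def)
  obtain g where g: "g \<in> l2_closure S" and w: "(\<lambda>z. f z - g z) \<in> l2_orth (l2_closure S)"
    using l2_projection_exists[OF l2_subspace_closure[OF S] l2_closure_idem[OF \<open>S \<subseteq> L2\<close>] f] .
  let ?w = "\<lambda>z. f z - g z"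
  have wL2: "?w \<in> L2" and gL2: "g \<in> L2" using w g by (auto simp: l2_orth_def l2_closure_def)
  have "?w \<in> l2_orth S" using w l2_closure_incl[OF \<open>S \<subseteq> L2\<close>] by (auto simp: l2_orth_def)
  then have "l2_inner f ?w = 0" by (rule assms(3))
  moreover have "l2_inner ?w g = 0" using w g by (simp add: l2_orth_def)
  ultimately have "l2_inner ?w ?w = 0"
    using l2_inner_diff_left[OF f gL2 wL2] l2_inner_commute[of g ?w] by simp
  then have w0: "l2_norm ?w = 0" by (simp add: l2_inner_self)
  show ?thesis
  proof -
    have "\<exists>h\<in>S. l2_norm (\<lambda>z. f z - h z) < \<epsilon>" if "\<epsilon> > 0" for \<epsilon>
    proof -
      obtain h where h: "h \<in> S" "l2_norm (\<lambda>z. g z - h z) < \<epsilon>"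
        using g \<open>\<epsilon> > 0\<close> unfolding l2_closure_def by blast
      moreover have "l2_norm (\<lambda>z. f z - h z) \<le> l2_norm ?w + l2_norm (\<lambda>z. g z - h z)"
        using h \<open>S \<subseteq> L2\<close> by (intro l2_norm_triangle_diff f gL2) auto
      ultimately show ?thesis using w0 by (intro bexI[of _ h]) auto
    qed
    with f show ?thesis by (simp add: l2_closure_def)
  qed
qed

section \<open>Trigonometric polynomials\<close>

text \<open>
  Conjugate powers stand in for the negative powers of \<open>z\<close>. With this choice the set is closed under
  products, conjugates and real parts of \<open>z\<close> as a set of functions on the plane, and not merely
  after restriction to the circle.
\<close>

inductive_set trig :: "(complex \<Rightarrow> complex) set" where
  monomial: "(\<lambda>z. c * z ^ m * cnj z ^ n) \<in> trig"
| add: "p \<in> trig \<Longrightarrow> q \<in> trig \<Longrightarrow> (\<lambda>z. p z + q z) \<in> trig"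

lemma trig_const: "(\<lambda>z. c) \<in> trig"
  using trig.monomial[of c 0 0] by simp

lemma trig_mult_monomial:
  assumes "q \<in> trig" shows "(\<lambda>z. (c * z ^ m * cnj z ^ n) * q z) \<in> trig"
  using assms
proof induction
  case (monomial d k l)
  have "(\<lambda>z. (c * z ^ m * cnj z ^ n) * (d * z ^ k * cnj z ^ l)) =
      (\<lambda>z. (c * d) * z ^ (m + k) * cnj z ^ (n + l))"
    by (simp add: power_add algebra_simps)
  then show ?case by (simp only: trig.monomial)
next
  case (add p q)
  then show ?case unfolding distrib_left by (intro trig.add)
qed

lemma trig_mult:
  assumes "p \<in> trig" "q \<in> trig" shows "(\<lambda>z. p z * q z) \<in> trig"
  using assms(1)
proof induction
  case (monomial c m n)
  show ?case by (rule trig_mult_monomial[OF assms(2)])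
next
  case (add p p')
  then show ?case unfolding distrib_right by (intro trig.add)
qed

lemma trig_cnj:
  assumes "p \<in> trig" shows "(\<lambda>z. cnj (p z)) \<in> trig"
  using assms
proof induction
  case (monomial c m n)
  show ?case using trig.monomial[of "cnj c" n m] by (simp add: mult_ac)
next
  case (add p q)
  then show ?case by (simp add: trig.add)
qed

lemma trig_real_polynomial:
  assumes "real_polynomial_function (p :: complex \<Rightarrow> real)"
  shows "(\<lambda>z. of_real (p z)) \<in> trig"
  using assms
proof induction
  case (linear f)
  interpret bounded_linear f by fact
  have "of_real (f z) = of_real (f 1 / 2) * (z + cnj z) + of_real (f \<i> / 2) * (- \<i>) * (z - cnj z)" for z
  proof -
    have "f z = f (Re z *\<^sub>R 1 + Im z *\<^sub>R \<i>)"
      by (rule arg_cong[of _ _ f]) (simp add: complex_eq_iff)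
    also have "\<dots> = Re z * f 1 + Im z * f \<i>" by (simp add: add scaleR)
    finally show ?thesis by (simp add: complex_eq_iff)
  qed
  note eq = this
  have "(\<lambda>z. complex_of_real (f z)) =
      (\<lambda>z. (of_real (f 1 / 2) + of_real (f \<i> / 2) * (- \<i>)) * z ^ 1 * cnj z ^ 0
         + (of_real (f 1 / 2) - of_real (f \<i> / 2) * (- \<i>)) * z ^ 0 * cnj z ^ 1)"
    unfolding eq by (simp add: algebra_simps add_divide_distrib diff_divide_distrib)
  then show ?case by (simp only: trig.add trig.monomial)
next
  case (const c)
  show ?case by (rule trig_const)
next
  case (add f g)
  then show ?case by (simp add: trig.add)
next
  case (mult f g)
  then show ?case by (simp add: trig_mult)
qed

lemma trig_measurable [measurable_dest]:
  assumes "p \<in> trig" shows "p \<in> borel_measurable borel"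
  using assms by induction measurable

lemma trig_bounded:
  assumes "p \<in> trig"
  obtains B where "\<And>z. cmod z = 1 \<Longrightarrow> cmod (p z) \<le> B"
proof -
  from assms have "\<exists>B. \<forall>z. cmod z = 1 \<longrightarrow> cmod (p z) \<le> B"
  proof induction
    case (monomial c m n)
    show ?case by (rule exI[of _ "cmod c"]) (simp add: norm_mult norm_power)
  next
    case (add p q)
    then obtain B C where "\<forall>z. cmod z = 1 \<longrightarrow> cmod (p z) \<le> B" "\<forall>z. cmod z = 1 \<longrightarrow> cmod (q z) \<le> C"
      by blast
    then have "\<forall>z. cmod z = 1 \<longrightarrow> cmod (p z + q z) \<le> B + C"
      by (meson add_mono norm_triangle_le)
    then show ?case by blast
  qed
  with that show thesis by blast
qed

lemma trig_AE_bounded: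
  assumes "p \<in> trig"
  obtains B where "AE z in circle. cmod (p z) \<le> B"
proof -
  obtain B where B: "\<And>z. cmod z = 1 \<Longrightarrow> cmod (p z) \<le> B" using trig_bounded[OF assms] by blast
  from AE_circle_norm have "AE z in circle. cmod (p z) \<le> B"
    by eventually_elim (rule B)
  then show thesis by (rule that)
qed

lemma trig_L2: "p \<in> trig \<Longrightarrow> p \<in> L2"
  using trig_AE_bounded L2_bounded trig_measurable by metis

lemma l2_subspace_trig: "l2_subspace trig"
  unfolding l2_subspace_def
  using trig_L2 trig_const trig_mult[OF trig_const] by (auto intro: trig.add)

text \<open>
  Real polynomials close to \<open>max 0 (1 - n dist(z, K))\<close> exist by the Weierstrass theorem. Their
  squares are uniformly bounded and converge to the indicator of \<open>K\<close>.
\<close>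

lemma trig_integral_nonpos_compact:
  fixes \<psi> :: "complex \<Rightarrow> real"
  assumes \<psi>: "integrable circle \<psi>"
    and nonpos: "\<And>p. p \<in> trig \<Longrightarrow> (\<integral>z. \<psi> z * (cmod (p z))\<^sup>2 \<partial>circle) \<le> 0"
    and K: "compact K"
  shows "(\<integral>z. \<psi> z * indicator K z \<partial>circle) \<le> 0"
proof (cases "K = {}")
  case False
  define k where "k n z = max 0 (1 - real n * infdist z K)" for n z
  have "\<exists>q. real_polynomial_function q \<and> (\<forall>z\<in>sphere 0 1. \<bar>k n z - q z\<bar> < 1 / real (Suc n))" for n
    by (rule Stone_Weierstrass_real_polynomial_function[of "sphere 0 1" "k n" "1 / real (Suc n)"])
      (auto simp: k_def[abs_def] intro!: continuous_intros)
  then obtain q where q: "\<And>n. real_polynomial_function (q n)"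
    and near: "\<And>n z. cmod z = 1 \<Longrightarrow> \<bar>k n z - q n z\<bar> < 1 / real (Suc n)"
    by (metis mem_sphere_0)
  have q_trig: "(\<lambda>z. complex_of_real (q n z)) \<in> trig" for n
    by (rule trig_real_polynomial[OF q])
  have q_meas [measurable]: "q n \<in> borel_measurable borel" for n
    using q continuous_on_polymonial_function real_polynomial_function_eq
    by (intro borel_measurable_continuous_onI) blast
  have [measurable]: "\<psi> \<in> borel_measurable borel"
    using borel_measurable_integrable[OF \<psi>] by (simp cong: measurable_cong_sets)
  have [measurable]: "K \<in> sets borel"
    using K by (simp add: compact_imp_closed)
  have k_lim: "(\<lambda>n. k n z) \<longlonglongrightarrow> indicator K z" for z
  proof (cases "z \<in> K")
    case True
    then show ?thesis by (simp add: k_def)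
  next
    case nz: False
    then have pos: "infdist z K > 0"
      using infdist_pos_not_in_closed[OF compact_imp_closed[OF K] \<open>K \<noteq> {}\<close>] by simp
    obtain N where N: "1 / infdist z K < real N" using reals_Archimedean2 by blast
    have "k n z = 0" if "n \<ge> N" for n
    proof -
      have "1 < real N * infdist z K" using N pos by (simp add: field_simps)
      also have "\<dots> \<le> real n * infdist z K" using that pos by (intro mult_right_mono) auto
      finally show ?thesis by (simp add: k_def)
    qed
    then have "\<forall>\<^sub>F n in sequentially. k n z = 0" by (auto simp: eventually_sequentially)
    with nz show ?thesis by (simp add: tendsto_eventually)
  qed
  have q_lim: "(\<lambda>n. q n z) \<longlonglongrightarrow> indicator K z" if z: "cmod z = 1" for z
  proof -
    have "(\<lambda>n. k n z - q n z) \<longlonglongrightarrow> 0"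
    proof (rule Lim_null_comparison)
      show "\<forall>\<^sub>F n in sequentially. norm (k n z - q n z) \<le> 1 / real (Suc n)"
        using near[OF z] by (intro always_eventually allI) (simp only: real_norm_def less_imp_le)
    qed (rule LIMSEQ_Suc[OF lim_1_over_n])
    from tendsto_diff[OF k_lim[of z] this] show ?thesis by simp
  qed
  have q_bound: "(q n z)\<^sup>2 \<le> 4" if z: "cmod z = 1" for n z
  proof -
    have "\<bar>k n z\<bar> \<le> 1" by (auto simp: k_def infdist_nonneg)
    moreover have "1 / real (Suc n) \<le> 1" by simp
    ultimately have "\<bar>q n z\<bar> \<le> 2" using near[OF z, of n] by linarith
    from power_mono[OF this, of 2] show ?thesis by simp
  qed
  have "(\<lambda>n. \<integral>z. \<psi> z * (q n z)\<^sup>2 \<partial>circle) \<longlonglongrightarrow> (\<integral>z. \<psi> z * indicator K z \<partial>circle)"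
  proof (rule integral_dominated_convergence)
    show "integrable circle (\<lambda>z. \<bar>\<psi> z\<bar> * 4)" using \<psi> by simp
    show "AE z in circle. (\<lambda>n. \<psi> z * (q n z)\<^sup>2) \<longlonglongrightarrow> \<psi> z * indicator K z"
      using AE_circle_norm
    proof eventually_elim
      fix z assume "cmod z = 1"
      from tendsto_mult[OF tendsto_const[of "\<psi> z"] tendsto_power[OF q_lim[OF this], of 2]]
      show "(\<lambda>n. \<psi> z * (q n z)\<^sup>2) \<longlonglongrightarrow> \<psi> z * indicator K z"
        by (cases "z \<in> K") simp_all
    qed
    show "AE z in circle. norm (\<psi> z * (q n z)\<^sup>2) \<le> \<bar>\<psi> z\<bar> * 4" for n
      using AE_circle_norm
      by eventually_elim (auto simp: abs_mult intro!: mult_left_mono q_bound)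
  qed measurable
  moreover have "(\<integral>z. \<psi> z * (q n z)\<^sup>2 \<partial>circle) \<le> 0" for n
    using nonpos[OF q_trig[of n]] by simp
  ultimately show ?thesis by (intro LIMSEQ_le_const2) auto
qed simp

text \<open>
  Otherwise the set where \<open>\<psi>\<close> is positive would, by inner regularity, contain a compact set of positive measure.
\<close>

lemma nonpos_AE_if_trig_integrals_nonpos:
  fixes \<psi> :: "complex \<Rightarrow> real"
  assumes \<psi>: "integrable circle \<psi>"
    and nonpos: "\<And>p. p \<in> trig \<Longrightarrow> (\<integral>z. \<psi> z * (cmod (p z))\<^sup>2 \<partial>circle) \<le> 0"
  shows "AE z in circle. \<psi> z \<le> 0"
proof -
  have meas [measurable]: "\<psi> \<in> borel_measurable borel"
    using borel_measurable_integrable[OF \<psi>] by (simp cong: measurable_cong_sets)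
  define U where "U = {z. \<psi> z > 0}"
  have U: "U \<in> sets borel" unfolding U_def by measurable
  have null: "emeasure circle K = 0" if "K \<subseteq> U" "compact K" for K
  proof -
    have [measurable]: "K \<in> sets borel" using that by (simp add: compact_imp_closed)
    have int: "integrable circle (\<lambda>z. \<psi> z * indicator K z)"
      by (rule integrable_real_mult_indicator) (use \<psi> in auto)
    have nn: "0 \<le> \<psi> z * indicator K z" for z
      using that by (auto simp: U_def indicator_def intro: less_imp_le)
    have "(\<integral>z. \<psi> z * indicator K z \<partial>circle) \<ge> 0"
      by (rule integral_nonneg_AE) (simp add: nn)
    with trig_integral_nonpos_compact[OF \<psi> nonpos \<open>compact K\<close>]
    have "(\<integral>z. \<psi> z * indicator K z \<partial>circle) = 0"
      by simp
    then have "AE z in circle. \<psi> z * indicator K z = 0"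
      using integral_nonneg_eq_0_iff_AE[OF int] nn by auto
    then have "AE z in circle. z \<notin> K"
      by eventually_elim (use that in \<open>auto simp: U_def\<close>)
    then show ?thesis
      by (subst (asm) AE_iff_measurable[of K]) (auto simp: that)
  qed
  have "emeasure circle U = (SUP K \<in> {K. K \<subseteq> U \<and> compact K}. emeasure circle K)"
    by (rule inner_regular) (use U in auto)
  also have "\<dots> = 0" using null by (auto intro!: antisym SUP_least)
  finally have "emeasure circle U = 0" .
  then have "AE z in circle. z \<notin> U"
    using U by (intro AE_not_in) (auto simp: null_sets_def)
  then show ?thesis by eventually_elim (simp add: U_def)
qed

text \<open>
  The real and imaginary parts of \<open>f\<close> and their negatives all pass the test for positivity, because \<open>\<bar>p\<bar>\<^sup>2\<close> is again a trigonometric polynomial.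
\<close>

lemma AE_zero_if_trig_integrals_zero:
  assumes f: "f \<in> L2" and zero: "\<And>p. p \<in> trig \<Longrightarrow> (\<integral>z. f z * p z \<partial>circle) = 0"
  shows "AE z in circle. f z = 0"
proof -
  have int: "integrable circle f" by (rule L2_integrable_1[OF f])
  have sq: "(\<integral>z. f z * of_real ((cmod (p z))\<^sup>2) \<partial>circle) = 0"
    and isq: "integrable circle (\<lambda>z. f z * of_real ((cmod (p z))\<^sup>2))" if "p \<in> trig" for p
    unfolding complex_norm_square using zero[OF trig_mult[OF that trig_cnj[OF that]]]
      L2_integrable_mult[OF f trig_L2[OF trig_mult[OF that trig_cnj[OF that]]]] by auto
  have Re0: "(\<integral>z. Re (f z) * (cmod (p z))\<^sup>2 \<partial>circle) = 0" if "p \<in> trig" for p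
    using integral_Re[OF isq[OF that]] sq[OF that] by simp
  have Im0: "(\<integral>z. Im (f z) * (cmod (p z))\<^sup>2 \<partial>circle) = 0" if "p \<in> trig" for p
    using integral_Im[OF isq[OF that]] sq[OF that] by simp
  have "AE z in circle. Re (f z) \<le> 0" "AE z in circle. - Re (f z) \<le> 0"
    "AE z in circle. Im (f z) \<le> 0" "AE z in circle. - Im (f z) \<le> 0"
    by (rule nonpos_AE_if_trig_integrals_nonpos; simp add: int Re0 Im0)+
  then show ?thesis
    by eventually_elim (simp add: complex_eq_iff)
qed

lemma AE_zero_if_orth_trig:
  assumes "f \<in> l2_orth trig" shows "AE z in circle. f z = 0"
proof (rule AE_zero_if_trig_integrals_zero)
  show "f \<in> L2" using assms by (simp add: l2_orth_def)
  show "(\<integral>z. f z * p z \<partial>circle) = 0" if "p \<in> trig" for p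
    using assms trig_cnj[OF that] by (auto simp: l2_orth_def l2_inner_def)
qed

lemma l2_closure_trig:
  assumes f: "f \<in> L2" shows "f \<in> l2_closure trig"
proof (rule l2_bipolar[OF l2_subspace_trig f])
  fix w assume w: "w \<in> l2_orth trig"
  from AE_zero_if_orth_trig[OF w] have "l2_norm w = 0"
    using w by (subst l2_norm_eq_0_iff) (auto simp: l2_orth_def)
  then show "l2_inner f w = 0"
    using l2_Cauchy_Schwarz[OF f, of w] w by (auto simp: l2_orth_def)
qed

section \<open>The Hardy space\<close>

lemma circle_powi:
  assumes "cmod z = 1" shows "z ^ a * cnj z ^ b = z powi (int a - int b)"
proof -
  have "z \<noteq> 0" using assms by auto
  moreover have "cnj z = inverse z"
    using assms \<open>z \<noteq> 0\<close> by (simp add: field_simps complex_norm_square[symmetric])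
  ultimately show ?thesis
    by (simp add: power_int_diff power_inverse divide_inverse)
qed

lemma fourier_coeff_eq_inner:
  assumes [measurable]: "f \<in> borel_measurable borel"
  shows "fourier_coeff f (int a - int b) = l2_inner f (\<lambda>z. z ^ a * cnj z ^ b)"
  unfolding fourier_coeff_def l2_inner_def
proof (rule integral_cong_AE)
  show "AE z in circle. f z * z powi - (int a - int b) = f z * cnj (z ^ a * cnj z ^ b)"
    using AE_circle_norm
    by eventually_elim (use circle_powi[of _ b a] in \<open>simp add: mult.commute\<close>)
qed measurable

lemma fourier_coeff_monomial:
  "fourier_coeff (\<lambda>z. c * z ^ a * cnj z ^ b) k = (if k = int a - int b then c else 0)"
proof -
  have "fourier_coeff (\<lambda>z. c * z ^ a * cnj z ^ b) k = (\<integral>z. c * (z powi (int a - int b - k)) \<partial>circle)"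
    unfolding fourier_coeff_def
  proof (rule integral_cong_AE)
    show "AE z in circle. c * z ^ a * cnj z ^ b * z powi - k = c * (z powi (int a - int b - k))"
      using AE_circle_norm
    proof eventually_elim
      fix z assume z: "cmod z = 1"
      then have "z \<noteq> 0" by auto
      then show "c * z ^ a * cnj z ^ b * z powi - k = c * (z powi (int a - int b - k))"
        using power_int_add[of z "int a - int b" "- k"] circle_powi[OF z, of a b] by (simp add: mult.assoc)
    qed
  qed measurable
  then show ?thesis by (simp add: integral_circle_powi)
qed

lemma l2_orth_antimono: "S \<subseteq> T \<Longrightarrow> l2_orth T \<subseteq> l2_orth S"
  by (auto simp: l2_orth_def)

lemma l2_subspace_orth: "S \<subseteq> L2 \<Longrightarrow> l2_subspace (l2_orth S)"
  unfolding l2_subspace_def l2_orth_def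
  by (auto simp: L2_zero L2_add L2_scale l2_inner_scale_left subset_iff l2_inner_add_left)

lemma l2_closure_orth:
  assumes "S \<subseteq> L2" shows "l2_closure (l2_orth S) \<subseteq> l2_orth S"
proof
  fix f assume f: "f \<in> l2_closure (l2_orth S)"
  then have fL2: "f \<in> L2" by (rule l2_closureD)
  have "l2_inner f h = 0" if h: "h \<in> S" for h
  proof -
    have hL2: "h \<in> L2" using h assms by auto
    have "cmod (l2_inner f h) \<le> 0 + e" if "e > 0" for e
    proof -
      have "e / (l2_norm h + 1) > 0" using \<open>e > 0\<close> by (simp add: add_nonneg_pos)
      then obtain g where g: "g \<in> l2_orth S" "l2_norm (\<lambda>z. f z - g z) < e / (l2_norm h + 1)"
        using f unfolding l2_closure_def by blast
      have gL2: "g \<in> L2" using g by (simp add: l2_orth_def)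
      have "l2_inner f h = l2_inner (\<lambda>z. f z - g z) h"
        using g h by (simp add: l2_inner_diff_left fL2 gL2 hL2 l2_orth_def)
      also have "cmod \<dots> \<le> l2_norm (\<lambda>z. f z - g z) * l2_norm h"
        by (intro l2_Cauchy_Schwarz L2_diff fL2 gL2 hL2)
      also have "\<dots> \<le> e / (l2_norm h + 1) * (l2_norm h + 1)"
        using g(2) \<open>e > 0\<close> by (intro mult_mono) auto
      also have "\<dots> = e"
        using l2_norm_nonneg[of h] by (simp add: add_nonneg_eq_0_iff)
      finally show ?thesis by simp
    qed
    then show ?thesis using field_le_epsilon[of "cmod (l2_inner f h)" 0] by simp
  qed
  with fL2 show "f \<in> l2_orth S" by (simp add: l2_orth_def)
qed

lemma H2_L2: "f \<in> H2 \<Longrightarrow> f \<in> L2"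
  by (simp add: H2_def)

lemma power_in_H2: "(\<lambda>z. z ^ n) \<in> H2"
  using fourier_coeff_monomial[of 1 n 0] trig_L2[OF trig.monomial[of 1 n 0]] by (simp add: H2_def)

lemma L2_cnj_powers: "range (\<lambda>n z. cnj z ^ Suc n) \<subseteq> L2"
proof (rule image_subsetI)
  fix n show "(\<lambda>z. cnj z ^ Suc n) \<in> L2"
    using trig_L2[OF trig.monomial[of 1 0 "Suc n"]] by simp
qed

lemma H2_eq_orth: "H2 = l2_orth (range (\<lambda>n z. cnj z ^ Suc n))"
proof -
  have "(\<forall>n<0. fourier_coeff f n = 0) \<longleftrightarrow> (\<forall>n. l2_inner f (\<lambda>z. cnj z ^ Suc n) = 0)" if "f \<in> L2" for f
  proof -
    have c: "fourier_coeff f (- int (Suc n)) = l2_inner f (\<lambda>z. cnj z ^ Suc n)" for n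
      using fourier_coeff_eq_inner[OF L2_measurable[OF that], of 0 "Suc n"] by simp
    have "\<exists>m. n = - int (Suc m)" if "n < 0" for n
      using that by (metis negD)
    with c show ?thesis by (metis neg_less_0_iff_less of_nat_0_less_iff zero_less_Suc)
  qed
  then show ?thesis by (auto simp: H2_def l2_orth_def simp del: power_Suc)
qed

lemma l2_subspace_H2: "l2_subspace H2"
  unfolding H2_eq_orth by (rule l2_subspace_orth[OF L2_cnj_powers])

lemma l2_closure_H2: "l2_closure H2 \<subseteq> H2"
  unfolding H2_eq_orth by (rule l2_closure_orth[OF L2_cnj_powers])

lemma hardy_proj:
  assumes "f \<in> L2"
  shows hardy_proj_H2: "hardy_proj f \<in> H2"
    and hardy_proj_orth: "(\<lambda>z. f z - hardy_proj f z) \<in> l2_orth H2"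
proof -
  have "\<exists>g. g \<in> H2 \<and> (\<lambda>z. f z - g z) \<in> l2_orth H2"
    using l2_projection_exists[OF l2_subspace_H2 l2_closure_H2 assms] by blast
  from someI_ex[OF this] show "hardy_proj f \<in> H2" "(\<lambda>z. f z - hardy_proj f z) \<in> l2_orth H2"
    by (auto simp: hardy_proj_def l2_proj_def)
qed

lemma hardy_proj_L2: "f \<in> L2 \<Longrightarrow> hardy_proj f \<in> L2"
  by (rule H2_L2[OF hardy_proj_H2])

lemma hardy_proj_closest:
  assumes f: "f \<in> L2" and s: "s \<in> H2"
  shows "l2_norm (\<lambda>z. f z - hardy_proj f z) \<le> l2_norm (\<lambda>z. f z - s z)"
proof (rule power2_le_imp_le)
  let ?a = "\<lambda>z. f z - hardy_proj f z" and ?b = "\<lambda>z. hardy_proj f z - s z"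
  note P = hardy_proj_L2[OF f]
  have "l2_inner ?a ?b = l2_inner ?a (hardy_proj f) - l2_inner ?a s"
    by (intro l2_inner_diff_right L2_diff f P H2_L2[OF s])
  also have "\<dots> = 0"
    using hardy_proj_orth[OF f] hardy_proj_H2[OF f] s by (simp add: l2_orth_def)
  finally have "(l2_norm (\<lambda>z. ?a z + ?b z))\<^sup>2 = (l2_norm ?a)\<^sup>2 + (l2_norm ?b)\<^sup>2"
    by (intro l2_norm_Pythagoras L2_diff f P H2_L2[OF s])
  then show "(l2_norm ?a)\<^sup>2 \<le> (l2_norm (\<lambda>z. f z - s z))\<^sup>2" by simp
qed simp

lemma AE_zero_if_fourier_coeff_zero:
  assumes f: "f \<in> L2" and zero: "\<And>n. fourier_coeff f n = 0"
  shows "AE z in circle. f z = 0"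
proof (rule AE_zero_if_orth_trig)
  have "l2_inner f p = 0" if "p \<in> trig" for p
    using that
  proof induction
    case (monomial c m n)
    have "l2_inner f (\<lambda>z. z ^ m * cnj z ^ n) = 0"
      using fourier_coeff_eq_inner[OF L2_measurable[OF f], of m n] zero by simp
    then show ?case
      using l2_inner_scale_right[of f c "\<lambda>z. z ^ m * cnj z ^ n"] by (simp add: mult.assoc)
  next
    case (add p q)
    then show ?case by (simp add: l2_inner_add_right f trig_L2)
  qed
  with f show "f \<in> l2_orth trig" by (simp add: l2_orth_def)
qed

text \<open>
  The projection of \<open>u\<close> to \<open>H\<^sup>2\<close> has the coefficients of \<open>u\<close> at nonnegative indices and zeros elsewhere, so
  it vanishes.
\<close>

lemma orth_H2I:
  assumes u: "u \<in> L2" and zero: "\<And>n::nat. fourier_coeff u (int n) = 0"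
  shows "u \<in> l2_orth H2"
proof -
  let ?g = "hardy_proj u"
  have g: "?g \<in> H2" and gL2: "?g \<in> L2" using u by (auto intro: hardy_proj_H2 hardy_proj_L2)
  have orth: "(\<lambda>z. u z - ?g z) \<in> l2_orth H2" by (rule hardy_proj_orth[OF u])
  have "fourier_coeff ?g n = 0" for n
  proof (cases "n < 0")
    case True
    then show ?thesis using g by (simp add: H2_def)
  next
    case False
    then obtain m where m: "n = int m" by (metis nat_0_le not_less)
    note z = power_in_H2[of m]
    have "l2_inner (\<lambda>z. u z - ?g z) (\<lambda>z. z ^ m) = 0"
      using orth z by (simp add: l2_orth_def)
    with l2_inner_diff_left[OF u gL2 H2_L2[OF z]] show ?thesis
      using zero[of m] fourier_coeff_eq_inner[OF L2_measurable[OF u], of m 0]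
        fourier_coeff_eq_inner[OF L2_measurable[OF gL2], of m 0] by (simp add: m)
  qed
  from AE_zero_if_fourier_coeff_zero[OF gL2 this] have "l2_norm ?g = 0"
    using l2_norm_eq_0_iff[OF gL2] by simp
  then have "l2_inner ?g h = 0" if "h \<in> H2" for h
    using l2_Cauchy_Schwarz[OF gL2 H2_L2[OF that]] by simp
  moreover have "l2_inner (\<lambda>z. u z - ?g z) h = 0" if "h \<in> H2" for h
    using orth that by (simp add: l2_orth_def)
  ultimately have "l2_inner u h = 0" if "h \<in> H2" for h
    using l2_inner_diff_left[OF u gL2 H2_L2[OF that]] that by simp
  with u show ?thesis by (simp add: l2_orth_def)
qed

section \<open>Shifting frequencies\<close>

lemma trig_shift:
  assumes "p \<in> trig"
  shows "\<exists>N. \<forall>n\<ge>N. (\<lambda>z. z ^ n * p z) \<in> H2 \<and> (\<lambda>z. cnj z ^ n * p z) \<in> l2_orth H2"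
proof -
  note H2_add = l2_subspaceD(3)[OF l2_subspace_H2]
  have orth_add: "(\<lambda>z. f z + g z) \<in> l2_orth H2" if "f \<in> l2_orth H2" "g \<in> l2_orth H2" for f g
    using l2_subspaceD(3)[OF l2_subspace_orth that] H2_L2 by auto
  from assms show ?thesis
  proof induction
    case (monomial c a b)
    show ?case
    proof (intro exI[of _ "Suc (a + b)"] allI impI conjI)
      fix n assume n: "n \<ge> Suc (a + b)"
      have 1: "(\<lambda>z. z ^ n * (c * z ^ a * cnj z ^ b)) = (\<lambda>z. c * z ^ (n + a) * cnj z ^ b)"
        by (simp add: power_add mult_ac)
      show "(\<lambda>z. z ^ n * (c * z ^ a * cnj z ^ b)) \<in> H2"
        unfolding 1 H2_def using n by (auto simp: fourier_coeff_monomial trig_L2 trig.monomial)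
      have 2: "(\<lambda>z. cnj z ^ n * (c * z ^ a * cnj z ^ b)) = (\<lambda>z. c * z ^ a * cnj z ^ (n + b))"
        by (simp add: power_add mult_ac)
      show "(\<lambda>z. cnj z ^ n * (c * z ^ a * cnj z ^ b)) \<in> l2_orth H2"
        unfolding 2 using n by (intro orth_H2I trig_L2 trig.monomial) (auto simp: fourier_coeff_monomial)
    qed
  next
    case (add p q)
    then obtain M N where
      "\<forall>n\<ge>M. (\<lambda>z. z ^ n * p z) \<in> H2 \<and> (\<lambda>z. cnj z ^ n * p z) \<in> l2_orth H2"
      "\<forall>n\<ge>N. (\<lambda>z. z ^ n * q z) \<in> H2 \<and> (\<lambda>z. cnj z ^ n * q z) \<in> l2_orth H2" by blast
    then show ?case
      by (intro exI[of _ "max M N"]) (auto simp: distrib_left intro!: H2_add orth_add)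
  qed
qed

lemma AE_circle_power_norm: "AE z in circle. cmod (z ^ n) = 1"
  using AE_circle_norm by eventually_elim (simp add: norm_power)

lemma AE_circle_cnj_power_norm: "AE z in circle. cmod (cnj z ^ n) = 1"
  using AE_circle_norm by eventually_elim (simp add: norm_power)

lemma L2_shift: "u \<in> L2 \<Longrightarrow> (\<lambda>z. z ^ n * u z) \<in> L2"
  by (rule L2_mult_bounded[where C = 1]) (use AE_circle_power_norm[of n] in auto)

lemma l2_norm_shift: "u \<in> L2 \<Longrightarrow> l2_norm (\<lambda>z. z ^ n * u z) = l2_norm u"
  by (intro l2_norm_mult_unimodular AE_circle_power_norm) (auto dest: L2_measurable)

lemma l2_norm_shift_diff:
  "\<lbrakk>u \<in> L2; v \<in> L2\<rbrakk> \<Longrightarrow> l2_norm (\<lambda>z. z ^ n * u z - z ^ n * v z) = l2_norm (\<lambda>z. u z - v z)"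
  using l2_norm_shift[OF L2_diff, of u v n] by (simp add: right_diff_distrib)

lemma trig_approx:
  assumes "u \<in> L2" "e > 0"
  obtains p where "p \<in> trig" "l2_norm (\<lambda>z. u z - p z) < e"
  using l2_closure_trig[OF assms(1)] assms(2) unfolding l2_closure_def by blast

text \<open>
  For large \<open>n\<close>, multiplication by \<open>z\<^sup>n\<close> moves all of \<open>u\<close> but a small part into \<open>H\<^sup>2\<close>, and it sends
  \<open>u\<close> weakly to zero. Both facts are clear for trigonometric polynomials, and pass to \<open>u\<close> because
  multiplication by \<open>z\<^sup>n\<close> is isometric.
\<close>

lemma shift_tendsto_H2:
  assumes u: "u \<in> L2"
  shows "(\<lambda>n. l2_norm (\<lambda>z. z ^ n * u z - hardy_proj (\<lambda>z. z ^ n * u z) z)) \<longlonglongrightarrow> 0"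
proof (rule LIMSEQ_I)
  fix e :: real assume "e > 0"
  obtain p where p: "p \<in> trig" "l2_norm (\<lambda>z. u z - p z) < e"
    using trig_approx[OF u \<open>e > 0\<close>] .
  obtain N where N: "\<forall>n\<ge>N. (\<lambda>z. z ^ n * p z) \<in> H2"
    using trig_shift[OF p(1)] by blast
  have "l2_norm (\<lambda>z. z ^ n * u z - hardy_proj (\<lambda>z. z ^ n * u z) z) < e" if "n \<ge> N" for n
    using hardy_proj_closest[OF L2_shift[OF u] N[rule_format, OF that], of n] p(2)
    by (simp add: l2_norm_shift_diff u trig_L2 p(1))
  then show "\<exists>N. \<forall>n\<ge>N. norm (l2_norm (\<lambda>z. z ^ n * u z - hardy_proj (\<lambda>z. z ^ n * u z) z) - 0) < e"
    by (intro exI[of _ N]) simp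
qed

lemma shift_weakly_null:
  assumes u: "u \<in> L2" and v: "v \<in> trig"
  shows "(\<lambda>n. l2_inner (\<lambda>z. z ^ n * u z) v) \<longlonglongrightarrow> 0"
proof (rule LIMSEQ_I)
  fix e :: real assume "e > 0"
  have vL2: "v \<in> L2" by (rule trig_L2[OF v])
  have pos: "e / (l2_norm v + 1) > 0" using \<open>e > 0\<close> by (simp add: add_nonneg_pos)
  obtain p where p: "p \<in> trig" and near: "l2_norm (\<lambda>z. u z - p z) < e / (l2_norm v + 1)"
    using trig_approx[OF u pos] .
  have pL2: "p \<in> L2" by (rule trig_L2[OF p])
  obtain N where N: "\<forall>n\<ge>N. (\<lambda>z. cnj z ^ n * (cnj (p z) * v z)) \<in> l2_orth H2"
    using trig_shift[OF trig_mult[OF trig_cnj[OF p] v]] by blast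
  have one: "(\<lambda>z. 1) \<in> H2" using power_in_H2[of 0] by simp
  have "norm (l2_inner (\<lambda>z. z ^ n * u z) v - 0) < e" if "n \<ge> N" for n
  proof -
    have "l2_inner v (\<lambda>z. z ^ n * p z) = l2_inner (\<lambda>z. cnj z ^ n * (cnj (p z) * v z)) (\<lambda>z. 1)"
      by (simp add: l2_inner_def mult_ac)
    also have "\<dots> = 0" using N that one by (simp add: l2_orth_def)
    finally have "l2_inner (\<lambda>z. z ^ n * p z) v = 0" using l2_inner_commute[of "\<lambda>z. z ^ n * p z" v] by simp
    then have "l2_inner (\<lambda>z. z ^ n * u z) v = l2_inner (\<lambda>z. z ^ n * u z - z ^ n * p z) v"
      by (simp add: l2_inner_diff_left L2_shift u pL2 vL2)
    also have "cmod \<dots> \<le> l2_norm (\<lambda>z. u z - p z) * l2_norm v"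
      using l2_Cauchy_Schwarz[OF L2_diff[OF L2_shift[OF u] L2_shift[OF pL2]] vL2, of n n]
      by (simp add: l2_norm_shift_diff u pL2)
    also have "\<dots> \<le> l2_norm (\<lambda>z. u z - p z) * (l2_norm v + 1)"
      by (intro mult_left_mono) auto
    also have "\<dots> < e / (l2_norm v + 1) * (l2_norm v + 1)"
      using near by (intro mult_strict_right_mono) (auto simp: add_nonneg_pos)
    also have "\<dots> = e"
      using l2_norm_nonneg[of v] by (simp add: add_nonneg_eq_0_iff)
    finally show ?thesis by simp
  qed
  then show "\<exists>N. \<forall>n\<ge>N. norm (l2_inner (\<lambda>z. z ^ n * u z) v - 0) < e" by blast
qed

section \<open>Inner functions\<close>

lemma inner_function_measurable: "inner_function \<theta> \<Longrightarrow> \<theta> \<in> borel_measurable borel"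
  by (simp add: inner_function_def cong: measurable_cong_sets)

lemma inner_function_AE_norm: "inner_function \<theta> \<Longrightarrow> AE z in circle. cmod (\<theta> z) = 1"
  by (simp add: inner_function_def)

text \<open>
  The power series of \<open>\<theta>\<close> at \<open>r z\<close> converges uniformly for \<open>z\<close> on the circle and may be integrated
  term by term.
\<close>

lemma inner_function_dilation_moment:
  assumes \<theta>: "inner_function \<theta>" and m: "m > 0" and r: "0 \<le> r" "r < 1"
  shows "(\<integral>z. \<theta> (of_real r * z) * z ^ m \<partial>circle) = 0"
proof -
  note [measurable] = inner_function_measurable[OF \<theta>]
  have hol: "\<theta> holomorphic_on ball 0 1" using \<theta> by (simp add: inner_function_def)
  define a where "a n = (deriv ^^ n) \<theta> 0 / fact n" for n
  have sums: "(\<lambda>n. a n * w ^ n) sums \<theta> w" if "cmod w < 1" for w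
    using holomorphic_power_series[OF hol, of w] that by (simp add: a_def)
  obtain \<rho> where \<rho>: "r < \<rho>" "\<rho> < 1" using r(2) dense by blast
  have sm: "summable (\<lambda>n. norm (a n * of_real r ^ n))"
    using sums_summable[OF sums[of "of_real \<rho>"]] \<rho> r by (intro powser_insidea[where x = "of_real \<rho>"]) auto
  have "(\<lambda>N. \<integral>z. (\<Sum>n<N. a n * (of_real r * z) ^ n) * z ^ m \<partial>circle) \<longlonglongrightarrow>
      (\<integral>z. \<theta> (of_real r * z) * z ^ m \<partial>circle)"
  proof (rule integral_dominated_convergence)
    show "integrable circle (\<lambda>z. \<Sum>n. norm (a n * of_real r ^ n))" by simp
    show "AE z in circle. (\<lambda>N. (\<Sum>n<N. a n * (of_real r * z) ^ n) * z ^ m) \<longlonglongrightarrow> \<theta> (of_real r * z) * z ^ m"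
      using AE_circle_norm
    proof eventually_elim
      fix z assume "cmod z = 1"
      then have "cmod (of_real r * z) < 1" using r by (simp add: norm_mult)
      from tendsto_mult[OF sums[OF this, unfolded sums_def] tendsto_const[of "z ^ m"]]
      show "(\<lambda>N. (\<Sum>n<N. a n * (of_real r * z) ^ n) * z ^ m) \<longlonglongrightarrow> \<theta> (of_real r * z) * z ^ m" .
    qed
    show "AE z in circle. norm ((\<Sum>n<N. a n * (of_real r * z) ^ n) * z ^ m) \<le> (\<Sum>n. norm (a n * of_real r ^ n))" for N
      using AE_circle_norm
    proof eventually_elim
      fix z assume z: "cmod z = 1"
      have "norm ((\<Sum>n<N. a n * (of_real r * z) ^ n) * z ^ m) = norm (\<Sum>n<N. a n * (of_real r * z) ^ n)"
        using z by (simp add: norm_mult norm_power)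
      also have "\<dots> \<le> (\<Sum>n<N. norm (a n * (of_real r * z) ^ n))" by (rule norm_sum)
      also have "\<dots> = (\<Sum>n<N. norm (a n * of_real r ^ n))"
        using z by (simp add: norm_mult norm_power)
      also have "\<dots> \<le> (\<Sum>n. norm (a n * of_real r ^ n))"
        by (rule sum_le_suminf[OF sm]) auto
      finally show "norm ((\<Sum>n<N. a n * (of_real r * z) ^ n) * z ^ m) \<le> (\<Sum>n. norm (a n * of_real r ^ n))" .
    qed
  qed measurable
  moreover have "(\<integral>z. (\<Sum>n<N. a n * (of_real r * z) ^ n) * z ^ m \<partial>circle) = 0" for N
  proof -
    have int: "integrable circle (\<lambda>z. z ^ k)" for k
      using L2_integrable_1[OF trig_L2[OF trig.monomial[of 1 k 0]]] by simp
    have zero: "(\<integral>z. z ^ (n + m) \<partial>circle) = 0" for n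
      using integral_circle_powi[of "int (n + m)"] m by (simp del: of_nat_add)
    have "(\<Sum>n<N. a n * (of_real r * z) ^ n) * z ^ m = (\<Sum>n<N. (a n * of_real r ^ n) * z ^ (n + m))" for z
      unfolding sum_distrib_right by (intro sum.cong refl) (simp add: power_mult_distrib power_add mult_ac)
    then have "(\<integral>z. (\<Sum>n<N. a n * (of_real r * z) ^ n) * z ^ m \<partial>circle) =
        (\<Sum>n<N. (a n * of_real r ^ n) * (\<integral>z. z ^ (n + m) \<partial>circle))"
      using int by (simp add: Bochner_Integration.integral_sum)
    with zero show ?thesis by simp
  qed
  ultimately show ?thesis by (simp add: LIMSEQ_const_iff)
qed

text \<open>
  These integrals are the Fourier coefficients of \<open>\<theta>\<close> with negative index. The radial limit may be taken
  under the integral because \<open>\<theta>\<close> is bounded on the disk.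
\<close>

lemma inner_function_moment:
  assumes \<theta>: "inner_function \<theta>" and m: "m > 0"
  shows "(\<integral>z. \<theta> z * z ^ m \<partial>circle) = 0"
proof -
  note [measurable] = inner_function_measurable[OF \<theta>]
  define r where "r n = 1 - 1 / real (Suc n)" for n
  have r: "0 \<le> r n" "r n < 1" for n by (auto simp: r_def)
  have r_lim: "r \<longlonglongrightarrow> 1"
    using tendsto_diff[OF tendsto_const[of 1] LIMSEQ_Suc[OF lim_1_over_n]] by (simp add: r_def[abs_def])
  obtain B where "\<forall>w\<in>ball 0 1. cmod (\<theta> w) \<le> B"
    using \<theta> unfolding inner_function_def bounded_iff by auto
  then have B: "cmod (\<theta> w) \<le> B" if "cmod w < 1" for w
    using that by simp
  have "(\<lambda>n. \<integral>z. \<theta> (of_real (r n) * z) * z ^ m \<partial>circle) \<longlonglongrightarrow> (\<integral>z. \<theta> z * z ^ m \<partial>circle)"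
  proof (rule integral_dominated_convergence)
    show "integrable circle (\<lambda>z. B)" by simp
    have "AE z in circle. ((\<lambda>r::real. \<theta> (of_real r * z)) \<longlongrightarrow> \<theta> z) (at_left 1)"
      using \<theta> by (simp add: inner_function_def)
    then show "AE z in circle. (\<lambda>n. \<theta> (of_real (r n) * z) * z ^ m) \<longlonglongrightarrow> \<theta> z * z ^ m"
    proof eventually_elim
      fix z assume "((\<lambda>r::real. \<theta> (of_real r * z)) \<longlongrightarrow> \<theta> z) (at_left 1)"
      then have "(\<lambda>n. \<theta> (of_real (r n) * z)) \<longlonglongrightarrow> \<theta> z"
        unfolding tendsto_at_iff_sequentially using r r_lim by (auto simp: o_def)
      then show "(\<lambda>n. \<theta> (of_real (r n) * z) * z ^ m) \<longlonglongrightarrow> \<theta> z * z ^ m"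
        by (intro tendsto_intros)
    qed
    show "AE z in circle. norm (\<theta> (of_real (r n) * z) * z ^ m) \<le> B" for n
      using AE_circle_norm
      by eventually_elim (use r[of n] in \<open>simp add: norm_mult norm_power B\<close>)
  qed measurable
  then show ?thesis
    using inner_function_dilation_moment[OF \<theta> m r] by (simp add: LIMSEQ_const_iff)
qed

text \<open>
  The inner product of \<open>\<theta> h\<close> with \<open>cnj z ^ Suc n\<close> is that of \<open>h\<close> with \<open>cnj z ^ Suc n * cnj (\<theta> z)\<close>. The
  latter function has negative frequencies only, because \<open>\<theta>\<close> has none.
\<close>

lemma inner_function_mult_H2:
  assumes \<theta>: "inner_function \<theta>" and h: "h \<in> H2"
  shows "(\<lambda>z. \<theta> z * h z) \<in> H2"
proof -
  note meas [measurable] = inner_function_measurable[OF \<theta>]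
  note [measurable] = L2_measurable[OF H2_L2[OF h]]
  have bd: "AE z in circle. cmod (\<theta> z) \<le> 1"
    using inner_function_AE_norm[OF \<theta>] by eventually_elim simp
  have L2: "(\<lambda>z. \<theta> z * h z) \<in> L2"
    by (rule L2_mult_bounded[OF H2_L2[OF h] meas bd])
  have "l2_inner (\<lambda>z. \<theta> z * h z) (\<lambda>z. cnj z ^ Suc n) = 0" for n
  proof -
    let ?u = "\<lambda>z. cnj z ^ Suc n * cnj (\<theta> z)"
    have u: "?u \<in> L2"
    proof (rule L2_bounded[where C = 1])
      show "AE z in circle. cmod (cnj z ^ Suc n * cnj (\<theta> z)) \<le> 1"
        using bd AE_circle_norm by eventually_elim (simp add: norm_mult norm_power)
    qed measurable
    have "?u \<in> l2_orth H2"
    proof (rule orth_H2I[OF u])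
      fix k :: nat
      have "fourier_coeff ?u (int k) = l2_inner ?u (\<lambda>z. z ^ k)"
        using fourier_coeff_eq_inner[OF L2_measurable[OF u], of k 0] by simp
      also have "\<dots> = (\<integral>z. cnj (\<theta> z * z ^ (Suc n + k)) \<partial>circle)"
        by (simp add: l2_inner_def power_add mult_ac)
      also have "\<dots> = 0"
        using inner_function_moment[OF \<theta>, of "Suc n + k"] by (simp only: Bochner_Integration.integral_cnj) simp
      finally show "fourier_coeff ?u (int k) = 0" .
    qed
    then have "l2_inner ?u h = 0" using h by (simp add: l2_orth_def)
    then have "l2_inner h ?u = 0" using l2_inner_commute[of h ?u] by simp
    then show ?thesis by (simp add: l2_inner_def mult_ac)
  qed
  with L2 show ?thesis by (auto simp: H2_eq_orth l2_orth_def)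
qed

section \<open>The projection onto the complement of the model space\<close>

lemma inner_function_AE_le_1: "inner_function \<theta> \<Longrightarrow> AE z in circle. cmod (\<theta> z) \<le> 1"
  by (drule inner_function_AE_norm) (auto elim!: eventually_mono)

lemma L2_inner_function_mult: "inner_function \<theta> \<Longrightarrow> f \<in> L2 \<Longrightarrow> (\<lambda>z. \<theta> z * f z) \<in> L2"
  by (rule L2_mult_bounded[OF _ inner_function_measurable inner_function_AE_le_1])

lemma L2_inner_function_cnj_mult:
  assumes "inner_function \<theta>" "f \<in> L2" shows "(\<lambda>z. cnj (\<theta> z) * f z) \<in> L2"
  using inner_function_measurable[OF assms(1)] inner_function_AE_le_1[OF assms(1)]
  by (intro L2_mult_bounded[OF assms(2), where C = 1]) auto

lemma model_perp_proj_L2: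
  assumes "inner_function \<theta>" "f \<in> L2" shows "model_perp_proj \<theta> f \<in> L2"
  unfolding model_perp_proj_def hardy_perp_proj_def
  by (intro L2_add L2_diff L2_inner_function_mult hardy_proj_L2 L2_inner_function_cnj_mult assms)

text \<open>
  The two parts \<open>Q f\<close> and \<open>\<theta> c\<close>, where \<open>c = P (cnj \<theta> f)\<close>, are orthogonal because multiplication by \<open>\<theta>\<close> preserves
  \<open>H\<^sup>2\<close>. For the same reason \<open>c\<close> depends on \<open>P f\<close> only, which gives \<open>\<parallel>c\<parallel> \<le> \<parallel>P f\<parallel>\<close>.
\<close>

lemma model_perp_proj_contraction:
  assumes \<theta>: "inner_function \<theta>" and f: "f \<in> L2"
  shows "l2_norm (model_perp_proj \<theta> f) \<le> l2_norm f"
proof -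
  let ?u = "\<lambda>z. cnj (\<theta> z) * f z"
  let ?a = "hardy_proj f" and ?c = "hardy_proj ?u"
  let ?b = "\<lambda>z. f z - ?a z" and ?d = "\<lambda>z. \<theta> z * ?c z"
  have u: "?u \<in> L2" by (rule L2_inner_function_cnj_mult[OF \<theta> f])
  have a: "?a \<in> H2" "?a \<in> L2" using f by (auto intro: hardy_proj_H2 hardy_proj_L2)
  have c: "?c \<in> H2" "?c \<in> L2" using u by (auto intro: hardy_proj_H2 hardy_proj_L2)
  have b: "?b \<in> l2_orth H2" "?b \<in> L2" using hardy_proj_orth[OF f] by (auto simp: l2_orth_def)
  have d: "?d \<in> H2" "?d \<in> L2"
    using inner_function_mult_H2[OF \<theta> c(1)] L2_inner_function_mult[OF \<theta> c(2)] by auto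
  have norm_d: "l2_norm ?d = l2_norm ?c"
    by (rule l2_norm_mult_unimodular[OF L2_measurable[OF c(2)] inner_function_measurable[OF \<theta>] inner_function_AE_norm[OF \<theta>]])
  have bd: "l2_inner ?b ?d = 0" using b d by (simp add: l2_orth_def)
  have "l2_inner (\<lambda>z. ?u z - ?c z) ?c = 0"
    using hardy_proj_orth[OF u] c by (simp add: l2_orth_def)
  then have "l2_inner ?c ?c = l2_inner ?u ?c"
    using l2_inner_diff_left[OF u c(2) c(2)] by simp
  also have "\<dots> = l2_inner f ?d"
    by (simp add: l2_inner_def mult_ac)
  also have "\<dots> = l2_inner ?a ?d"
    using l2_inner_diff_left[OF f a(2) d(2)] bd by simp
  finally have "(l2_norm ?c)\<^sup>2 = cmod (l2_inner ?a ?d)"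
    by (metis l2_inner_self norm_of_real abs_of_nonneg zero_le_power2)
  also have "\<dots> \<le> l2_norm ?a * l2_norm ?c"
    using l2_Cauchy_Schwarz[OF a(2) d(2)] norm_d by simp
  finally have "l2_norm ?c * l2_norm ?c \<le> l2_norm ?a * l2_norm ?c" by (simp add: power2_eq_square)
  then have "l2_norm ?c \<le> l2_norm ?a"
    using l2_norm_nonneg[of ?c] by (cases "l2_norm ?c = 0") (simp_all add: mult_le_cancel_right)
  then have le: "(l2_norm ?c)\<^sup>2 \<le> (l2_norm ?a)\<^sup>2" by (intro power_mono) auto
  have ba: "l2_inner ?b ?a = 0" using b a by (simp add: l2_orth_def)
  have "(l2_norm (\<lambda>z. ?b z + ?d z))\<^sup>2 = (l2_norm ?b)\<^sup>2 + (l2_norm ?c)\<^sup>2"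
    using l2_norm_Pythagoras[OF b(2) d(2) bd] norm_d by simp
  also have "\<dots> \<le> (l2_norm ?b)\<^sup>2 + (l2_norm ?a)\<^sup>2" using le by simp
  also have "\<dots> = (l2_norm f)\<^sup>2"
    using l2_norm_Pythagoras[OF b(2) a(2) ba] by simp
  finally have "(l2_norm (\<lambda>z. ?b z + ?d z))\<^sup>2 \<le> (l2_norm f)\<^sup>2" .
  then show ?thesis
    unfolding model_perp_proj_def hardy_perp_proj_def by (rule power2_le_imp_le) simp
qed

text \<open>
  Since \<open>\<theta>\<close> is unimodular, \<open>f - \<theta> P u\<close> has the size of \<open>u - P u\<close>. The error is thus small when both \<open>f\<close>
  and \<open>u = cnj \<theta> f\<close> are close to \<open>H\<^sup>2\<close>, which is the case after a large shift.
\<close>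

lemma model_perp_proj_error:
  assumes \<theta>: "inner_function \<theta>" and f: "f \<in> L2"
  defines "u \<equiv> \<lambda>z. cnj (\<theta> z) * f z"
  shows "l2_norm (\<lambda>z. f z - model_perp_proj \<theta> f z) \<le>
    l2_norm (\<lambda>z. f z - hardy_proj f z) + l2_norm (\<lambda>z. u z - hardy_proj u z)"
proof -
  have u: "u \<in> L2" unfolding u_def by (rule L2_inner_function_cnj_mult[OF \<theta> f])
  note Pf = hardy_proj_L2[OF f] and Pu = hardy_proj_L2[OF u]
  note \<theta>Pu = L2_inner_function_mult[OF \<theta> Pu]
  have "l2_norm (\<lambda>z. f z - model_perp_proj \<theta> f z) = l2_norm (\<lambda>z. hardy_proj f z - \<theta> z * hardy_proj u z)"
    by (simp add: model_perp_proj_def hardy_perp_proj_def u_def[symmetric])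
  also have "\<dots> \<le> l2_norm (\<lambda>z. hardy_proj f z - f z) + l2_norm (\<lambda>z. f z - \<theta> z * hardy_proj u z)"
    by (rule l2_norm_triangle_diff[OF Pf f \<theta>Pu])
  also have "l2_norm (\<lambda>z. hardy_proj f z - f z) = l2_norm (\<lambda>z. f z - hardy_proj f z)"
    by (rule l2_norm_minus_commute)
  also have "l2_norm (\<lambda>z. f z - \<theta> z * hardy_proj u z) = l2_norm (\<lambda>z. u z - hardy_proj u z)"
  proof (rule l2_norm_AE_cong)
    show "AE z in circle. cmod (f z - \<theta> z * hardy_proj u z) = cmod (u z - hardy_proj u z)"
      using inner_function_AE_norm[OF \<theta>]
    proof eventually_elim
      fix z assume 1: "cmod (\<theta> z) = 1"
      then have "\<theta> z * cnj (\<theta> z) = 1" by (simp add: complex_norm_square[symmetric])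
      then have "\<theta> z * (u z - hardy_proj u z) = f z - \<theta> z * hardy_proj u z"
        by (simp add: u_def right_diff_distrib mult.assoc[symmetric])
      from arg_cong[OF this, of cmod] 1
      show "cmod (f z - \<theta> z * hardy_proj u z) = cmod (u z - hardy_proj u z)"
        by (simp add: norm_mult)
    qed
  qed (use L2_diff[OF f \<theta>Pu] L2_diff[OF u Pu] in \<open>auto dest: L2_measurable\<close>)
  finally show ?thesis .
qed

lemma model_perp_proj_shift:
  assumes \<theta>: "inner_function \<theta>" and G: "G \<in> L2"
  shows "(\<lambda>n. l2_norm (\<lambda>z. z ^ n * G z - model_perp_proj \<theta> (\<lambda>z. z ^ n * G z) z)) \<longlonglongrightarrow> 0"
proof (rule Lim_null_comparison)
  let ?E = "\<lambda>f. l2_norm (\<lambda>z. f z - hardy_proj f z)"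
  let ?H = "\<lambda>z. cnj (\<theta> z) * G z"
  show "\<forall>\<^sub>F n in sequentially. norm (l2_norm (\<lambda>z. z ^ n * G z - model_perp_proj \<theta> (\<lambda>z. z ^ n * G z) z)) \<le>
      ?E (\<lambda>z. z ^ n * G z) + ?E (\<lambda>z. z ^ n * ?H z)"
    using model_perp_proj_error[OF \<theta> L2_shift[OF G]]
    by (intro always_eventually allI) (simp add: mult.left_commute)
  show "(\<lambda>n. ?E (\<lambda>z. z ^ n * G z) + ?E (\<lambda>z. z ^ n * ?H z)) \<longlonglongrightarrow> 0"
    using tendsto_add[OF shift_tendsto_H2[OF G] shift_tendsto_H2[OF L2_inner_function_cnj_mult[OF \<theta> G]]] by simp
qed

section \<open>Bounded functions\<close>

lemma Linf_measurable: "f \<in> Linf \<Longrightarrow> f \<in> borel_measurable borel"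
  by (simp add: Linf_def cong: measurable_cong_sets)

lemma linf_norm_le:
  assumes [measurable]: "f \<in> borel_measurable borel" and "AE z in circle. cmod (f z) \<le> C"
  shows "linf_norm f \<le> ennreal C"
  unfolding linf_norm_def using assms(2)
  by (intro esssup_I) (auto intro: ennreal_leI elim!: eventually_mono)

lemma LinfI: "f \<in> borel_measurable borel \<Longrightarrow> AE z in circle. cmod (f z) \<le> C \<Longrightarrow> f \<in> Linf"
  using linf_norm_le[of f C] le_less_trans[of "linf_norm f" "ennreal C" \<infinity>]
  by (simp add: Linf_def cong: measurable_cong_sets)

lemma Linf_AE_le:
  assumes "f \<in> Linf" shows "AE z in circle. cmod (f z) \<le> enn2real (linf_norm f)"
proof -
  have fin: "linf_norm f < \<infinity>" using assms by (simp add: Linf_def)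
  have "AE z in circle. ennreal (cmod (f z)) \<le> linf_norm f"
    unfolding linf_norm_def by (rule esssup_AE)
  then show ?thesis
  proof eventually_elim
    fix z assume "ennreal (cmod (f z)) \<le> linf_norm f"
    from enn2real_mono[OF this] fin show "cmod (f z) \<le> enn2real (linf_norm f)" by simp
  qed
qed

lemma L2_mult_Linf:
  assumes "\<phi> \<in> Linf" "h \<in> L2" shows "(\<lambda>z. \<phi> z * h z) \<in> L2"
  by (rule L2_mult_bounded[OF assms(2) Linf_measurable[OF assms(1)] Linf_AE_le[OF assms(1)]])

lemma trig_Linf: "p \<in> trig \<Longrightarrow> p \<in> Linf"
  using trig_AE_bounded LinfI trig_measurable by metis

section \<open>The complement of the model space\<close>

lemma model_perp_L2: "model_perp \<theta> \<subseteq> L2"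
  by (auto simp: model_perp_def l2_orth_def)

lemma model_space_L2: "model_space \<theta> \<subseteq> L2"
  by (auto simp: model_space_def l2_orth_def)

lemma orth_H2_model_perp: "f \<in> l2_orth H2 \<Longrightarrow> f \<in> model_perp \<theta>"
  unfolding model_perp_def using l2_orth_antimono[of "model_space \<theta>" H2] by (auto simp: model_space_def)

lemma inner_mult_H2_model_perp:
  assumes \<theta>: "inner_function \<theta>" and h: "h \<in> H2"
  shows "(\<lambda>z. \<theta> z * h z) \<in> model_perp \<theta>"
  unfolding model_perp_def l2_orth_def
proof (intro CollectI conjI ballI)
  show "(\<lambda>z. \<theta> z * h z) \<in> L2" by (rule L2_inner_function_mult[OF \<theta> H2_L2[OF h]])
  fix k assume "k \<in> model_space \<theta>"
  then have "l2_inner k (\<lambda>z. \<theta> z * h z) = 0" using h by (auto simp: model_space_def l2_orth_def)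
  then show "l2_inner (\<lambda>z. \<theta> z * h z) k = 0" using l2_inner_commute[of "\<lambda>z. \<theta> z * h z" k] by simp
qed

lemma l2_subspace_bounded_model_perp: "l2_subspace (model_perp \<theta> \<inter> Linf)"
proof -
  note M = l2_subspaceD[OF l2_subspace_orth[OF model_space_L2[of \<theta>]], folded model_perp_def]
  have add: "(\<lambda>z. f z + g z) \<in> Linf" if "f \<in> Linf" "g \<in> Linf" for f g
  proof (rule LinfI)
    show "(\<lambda>z. f z + g z) \<in> borel_measurable borel"
      using that[THEN Linf_measurable] by simp
    show "AE z in circle. cmod (f z + g z) \<le> enn2real (linf_norm f) + enn2real (linf_norm g)"
      using that[THEN Linf_AE_le] by eventually_elim (meson add_mono norm_triangle_le)
  qed
  have scale: "(\<lambda>z. c * f z) \<in> Linf" if "f \<in> Linf" for c f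
  proof (rule LinfI)
    show "(\<lambda>z. c * f z) \<in> borel_measurable borel"
      using that[THEN Linf_measurable] by simp
    show "AE z in circle. cmod (c * f z) \<le> cmod c * enn2real (linf_norm f)"
      using that[THEN Linf_AE_le] by eventually_elim (simp add: norm_mult mult_left_mono)
  qed
  have "(\<lambda>z. 0) \<in> Linf" by (rule LinfI[where C = 0]) auto
  with M add scale show ?thesis by (auto simp: l2_subspace_def)
qed

text \<open>
  A function \<open>w\<close> orthogonal to all bounded functions in \<open>K\<^sub>\<theta>\<^sup>\<bottom>\<close> is orthogonal to the negative powers
  of \<open>z\<close>, so it lies in \<open>H\<^sup>2\<close>, and orthogonal to the functions \<open>\<theta> z\<^sup>n\<close>, so it lies in \<open>K\<^sub>\<theta>\<close>.
\<close>

lemma bounded_model_perp_dense: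
  assumes \<theta>: "inner_function \<theta>"
  shows "l2_dense_in (model_perp \<theta> \<inter> Linf) (model_perp \<theta>)"
proof -
  let ?D = "model_perp \<theta> \<inter> Linf"
  have "f \<in> l2_closure ?D" if f: "f \<in> model_perp \<theta>" for f
  proof (rule l2_bipolar[OF l2_subspace_bounded_model_perp])
    show "f \<in> L2" using f model_perp_L2 by auto
    fix w assume w: "w \<in> l2_orth ?D"
    then have wL2: "w \<in> L2" by (simp add: l2_orth_def)
    have "l2_inner w (\<lambda>z. cnj z ^ Suc n) = 0" for n
    proof -
      have mon: "(\<lambda>z. cnj z ^ Suc n) = (\<lambda>z. 1 * z ^ 0 * cnj z ^ Suc n)" by simp
      have "(\<lambda>z. cnj z ^ Suc n) \<in> l2_orth H2"
        unfolding mon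
      proof (intro orth_H2I trig_L2 trig.monomial)
        fix k show "fourier_coeff (\<lambda>z. 1 * z ^ 0 * cnj z ^ Suc n) (int k) = 0"
          unfolding fourier_coeff_monomial by simp
      qed
      moreover have "(\<lambda>z. cnj z ^ Suc n) \<in> Linf"
        unfolding mon by (intro trig_Linf trig.monomial)
      ultimately show ?thesis using w by (auto simp: l2_orth_def orth_H2_model_perp simp del: power_Suc)
    qed
    with wL2 have wH2: "w \<in> H2" by (auto simp: H2_eq_orth l2_orth_def)
    let ?v = "\<lambda>z. cnj (\<theta> z) * w z"
    have v: "?v \<in> L2" by (rule L2_inner_function_cnj_mult[OF \<theta> wL2])
    have v_orth: "?v \<in> l2_orth H2"
    proof (rule orth_H2I[OF v])
      fix n :: nat
      note z = power_in_H2[of n]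
      have "(\<lambda>z. \<theta> z * z ^ n) \<in> Linf"
      proof (rule LinfI)
        note [measurable] = inner_function_measurable[OF \<theta>]
        show "(\<lambda>z. \<theta> z * z ^ n) \<in> borel_measurable borel" by measurable
        show "AE z in circle. cmod (\<theta> z * z ^ n) \<le> 1"
          using inner_function_AE_norm[OF \<theta>] AE_circle_norm by eventually_elim (simp add: norm_mult norm_power)
      qed
      then have "l2_inner w (\<lambda>z. \<theta> z * z ^ n) = 0"
        using w inner_mult_H2_model_perp[OF \<theta> z] by (auto simp: l2_orth_def)
      then show "fourier_coeff ?v (int n) = 0"
        using fourier_coeff_eq_inner[OF L2_measurable[OF v], of n 0] by (simp add: l2_inner_def mult_ac)
    qed
    have "l2_inner w (\<lambda>z. \<theta> z * h z) = 0" if "h \<in> H2" for h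
    proof -
      have "l2_inner ?v h = 0" using v_orth that by (simp add: l2_orth_def)
      then show ?thesis by (simp add: l2_inner_def mult_ac)
    qed
    with wH2 wL2 have "w \<in> model_space \<theta>" by (auto simp: model_space_def l2_orth_def)
    with f show "l2_inner f w = 0" by (simp add: model_perp_def l2_orth_def)
  qed
  then show ?thesis
    unfolding l2_dense_in_def l2_closure_def by auto
qed

section \<open>Dual truncated Hankel operators\<close>

lemma hankel_norm_le:
  assumes "inner_function \<theta>" "(\<lambda>z. \<phi> z * h z) \<in> L2"
  shows "l2_norm (dual_trunc_hankel \<theta> \<phi> h) \<le> l2_norm (\<lambda>z. \<phi> z * h z)"
  unfolding dual_trunc_hankel_def
  using model_perp_proj_contraction[OF assms(1) L2_flip[OF assms(2)]] l2_norm_flip[OF L2_measurable[OF assms(2)]]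
  by simp

lemma hankel_L2:
  assumes "inner_function \<theta>" "(\<lambda>z. \<phi> z * h z) \<in> L2"
  shows "dual_trunc_hankel \<theta> \<phi> h \<in> L2"
  unfolding dual_trunc_hankel_def by (rule model_perp_proj_L2[OF assms(1) L2_flip[OF assms(2)]])

lemma hankel_norm_le_linf:
  assumes "inner_function \<theta>" "\<phi> \<in> Linf" "h \<in> L2"
  shows "l2_norm (dual_trunc_hankel \<theta> \<phi> h) \<le> enn2real (linf_norm \<phi>) * l2_norm h"
  using hankel_norm_le[OF assms(1) L2_mult_Linf[OF assms(2,3)]]
    l2_norm_mult_bounded[OF assms(3) Linf_measurable[OF assms(2)] Linf_AE_le[OF assms(2)]]
  by simp

text \<open>
  The flip turns the factor \<open>cnj z ^ n\<close> into \<open>z\<^sup>n\<close>, and the projection hardly changes functions that have been shifted far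
  enough. The norms of the images of the test functions thus tend to the norm of \<open>\<phi> p\<close>.
\<close>

lemma hankel_shift:
  assumes \<theta>: "inner_function \<theta>" and "(\<lambda>z. \<phi> z * p z) \<in> L2"
  shows "(\<lambda>n. l2_norm (\<lambda>z. z ^ n * flip (\<lambda>z. \<phi> z * p z) z -
    dual_trunc_hankel \<theta> \<phi> (\<lambda>z. cnj z ^ n * p z) z)) \<longlonglongrightarrow> 0"
proof -
  have "dual_trunc_hankel \<theta> \<phi> (\<lambda>z. cnj z ^ n * p z) =
      model_perp_proj \<theta> (\<lambda>z. z ^ n * flip (\<lambda>z. \<phi> z * p z) z)" for n
    by (simp add: dual_trunc_hankel_def flip_def mult_ac)
  then show ?thesis using model_perp_proj_shift[OF \<theta> L2_flip[OF assms(2)]] by simp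
qed

lemma test_function_domain:
  assumes "p \<in> trig"
  shows "\<forall>\<^sub>F n in sequentially. (\<lambda>z. cnj z ^ n * p z) \<in> model_perp \<theta> \<inter> Linf"
proof -
  obtain N where N: "\<forall>n\<ge>N. (\<lambda>z. cnj z ^ n * p z) \<in> l2_orth H2"
    using trig_shift[OF assms] by blast
  have "(\<lambda>z. cnj z ^ n * p z) \<in> Linf" for n
    using trig_Linf[OF trig_mult[OF trig.monomial[of 1 0 n] assms]] by simp
  with N show ?thesis
    unfolding eventually_sequentially by (intro exI[of _ N]) (auto intro: orth_H2_model_perp)
qed

text \<open>
  On the unit sphere the operator almost attains \<open>\<parallel>\<phi> p\<parallel>\<close> along the functions \<open>cnj z ^ n * p z\<close>, where \<open>p\<close>
  is normalized. A bound for the operator is hence a bound for multiplication by \<open>\<phi>\<close> on trigonometric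
  polynomials.
\<close>

lemma hankel_bound_trig:
  assumes \<theta>: "inner_function \<theta>" and \<phi>: "\<phi> \<in> L2" and p: "p \<in> trig" and C: "C \<ge> 0"
    and bound: "\<And>h. \<lbrakk>h \<in> model_perp \<theta> \<inter> Linf; l2_norm h \<le> 1\<rbrakk> \<Longrightarrow> l2_norm (dual_trunc_hankel \<theta> \<phi> h) \<le> C"
  shows "l2_norm (\<lambda>z. \<phi> z * p z) \<le> C * l2_norm p"
proof (cases "l2_norm p = 0")
  case True
  then have "AE z in circle. p z = 0" using l2_norm_eq_0_iff[OF trig_L2[OF p]] by simp
  then have "AE z in circle. \<phi> z * p z = 0" by eventually_elim simp
  moreover have "(\<lambda>z. p z * \<phi> z) \<in> L2"
    using L2_mult_Linf[OF trig_Linf[OF p] \<phi>] .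
  ultimately have "l2_norm (\<lambda>z. \<phi> z * p z) = 0"
    using l2_norm_eq_0_iff[of "\<lambda>z. \<phi> z * p z"] by (simp add: mult.commute)
  with True show ?thesis by simp
next
  case False
  then have pos: "l2_norm p > 0" using l2_norm_nonneg[of p] by linarith
  define q where "q z = of_real (1 / l2_norm p) * p z" for z
  have q: "q \<in> trig" unfolding q_def[abs_def] by (rule trig_mult[OF trig_const p])
  have "l2_norm q = 1" 
    using l2_norm_scale[of "of_real (1 / l2_norm p)" p] pos by (simp add: q_def[abs_def] norm_divide)
  then have unit: "l2_norm (\<lambda>z. cnj z ^ n * q z) = 1" for n
    using l2_norm_mult_unimodular[OF trig_measurable[OF q] _ AE_circle_cnj_power_norm, of n] by simp
  have \<phi>q: "(\<lambda>z. \<phi> z * q z) \<in> L2"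
    using L2_mult_Linf[OF trig_Linf[OF q] \<phi>] by (simp add: mult.commute)
  let ?G = "flip (\<lambda>z. \<phi> z * q z)" and ?h = "\<lambda>n z. cnj z ^ n * q z"
  let ?T = "dual_trunc_hankel \<theta> \<phi>"
  let ?e = "\<lambda>n. l2_norm (\<lambda>z. z ^ n * ?G z - ?T (?h n) z)"
  have G: "?G \<in> L2" by (rule L2_flip[OF \<phi>q])
  have "\<forall>\<^sub>F n in sequentially. l2_norm (\<lambda>z. \<phi> z * q z) \<le> C + ?e n"
    using test_function_domain[OF q, of \<theta>]
  proof eventually_elim
    fix n assume n: "?h n \<in> model_perp \<theta> \<inter> Linf"
    have "(\<lambda>z. \<phi> z * ?h n z) \<in> L2"
      using L2_mult_Linf[OF _ \<phi>, of "?h n"] n by (simp add: mult.commute)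
    then have T: "?T (?h n) \<in> L2" by (rule hankel_L2[OF \<theta>])
    have "l2_norm (\<lambda>z. \<phi> z * q z) = l2_norm (\<lambda>z. z ^ n * ?G z)"
      using l2_norm_shift[OF G] l2_norm_flip[OF L2_measurable[OF \<phi>q]] by simp
    also have "\<dots> \<le> l2_norm (?T (?h n)) + ?e n"
      by (rule l2_norm_triangle_sub[OF L2_shift[OF G] T])
    also have "\<dots> \<le> C + ?e n" using bound[OF n] unit[of n] by simp
    finally show "l2_norm (\<lambda>z. \<phi> z * q z) \<le> C + ?e n" .
  qed
  moreover have "(\<lambda>n. C + ?e n) \<longlonglongrightarrow> C + 0"
    by (intro tendsto_intros hankel_shift[OF \<theta> \<phi>q])
  ultimately have "l2_norm (\<lambda>z. \<phi> z * q z) \<le> C"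
    using tendsto_lowerbound[of "\<lambda>n. C + ?e n" C sequentially] by simp
  moreover have "(\<lambda>z. \<phi> z * q z) = (\<lambda>z. of_real (1 / l2_norm p) * (\<phi> z * p z))"
    by (simp add: q_def mult_ac)
  ultimately have "l2_norm (\<lambda>z. \<phi> z * p z) / l2_norm p \<le> C"
    using pos by (simp only: l2_norm_scale) (simp add: norm_divide)
  then show ?thesis using pos by (simp add: pos_divide_le_eq)
qed

text \<open>
  The bound \<open>\<parallel>\<phi> p\<parallel> \<le> C \<parallel>p\<parallel>\<close> says that \<open>\<bar>\<phi>\<bar>\<^sup>2 - C\<^sup>2\<close> has nonpositive integrals against all \<open>\<bar>p\<bar>\<^sup>2\<close>.
\<close>

lemma hankel_bound_AE:
  assumes \<theta>: "inner_function \<theta>" and \<phi>: "\<phi> \<in> L2" and C: "C \<ge> 0"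
    and bound: "\<And>h. \<lbrakk>h \<in> model_perp \<theta> \<inter> Linf; l2_norm h \<le> 1\<rbrakk> \<Longrightarrow> l2_norm (dual_trunc_hankel \<theta> \<phi> h) \<le> C"
  shows "AE z in circle. cmod (\<phi> z) \<le> C"
proof -
  have "AE z in circle. (cmod (\<phi> z))\<^sup>2 - C\<^sup>2 \<le> 0"
  proof (rule nonpos_AE_if_trig_integrals_nonpos)
    show "integrable circle (\<lambda>z. (cmod (\<phi> z))\<^sup>2 - C\<^sup>2)"
      using L2_integrable[OF \<phi>] by simp
    fix p assume p: "p \<in> trig"
    have \<phi>p: "(\<lambda>z. \<phi> z * p z) \<in> L2"
      using L2_mult_Linf[OF trig_Linf[OF p] \<phi>] by (simp add: mult.commute)
    have "(\<integral>z. ((cmod (\<phi> z))\<^sup>2 - C\<^sup>2) * (cmod (p z))\<^sup>2 \<partial>circle) =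
        (\<integral>z. (cmod (\<phi> z * p z))\<^sup>2 - C\<^sup>2 * (cmod (p z))\<^sup>2 \<partial>circle)"
      by (simp add: norm_mult power_mult_distrib left_diff_distrib)
    also have "\<dots> = (l2_norm (\<lambda>z. \<phi> z * p z))\<^sup>2 - C\<^sup>2 * (l2_norm p)\<^sup>2"
      unfolding l2_norm_sq using L2_integrable[OF \<phi>p] L2_integrable[OF trig_L2[OF p]]
      by (subst Bochner_Integration.integral_diff) auto
    also have "\<dots> \<le> 0"
      using power_mono[OF hankel_bound_trig[OF \<theta> \<phi> p C bound], of 2] by (simp add: power_mult_distrib)
    finally show "(\<integral>z. ((cmod (\<phi> z))\<^sup>2 - C\<^sup>2) * (cmod (p z))\<^sup>2 \<partial>circle) \<le> 0" .
  qed
  then show ?thesis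
    by eventually_elim (use C in \<open>auto intro: power2_le_imp_le\<close>)
qed

lemma hankel_bounded_iff:
  assumes \<theta>: "inner_function \<theta>" and \<phi>: "\<phi> \<in> L2"
  shows "bounded_op (model_perp \<theta> \<inter> Linf) (dual_trunc_hankel \<theta> \<phi>) \<longleftrightarrow> \<phi> \<in> Linf"
proof
  assume "bounded_op (model_perp \<theta> \<inter> Linf) (dual_trunc_hankel \<theta> \<phi>)"
  then obtain C where C: "\<And>h. h \<in> model_perp \<theta> \<inter> Linf \<Longrightarrow> l2_norm (dual_trunc_hankel \<theta> \<phi> h) \<le> C * l2_norm h"
    unfolding bounded_op_def by blast
  have "AE z in circle. cmod (\<phi> z) \<le> \<bar>C\<bar>"
  proof (rule hankel_bound_AE[OF \<theta> \<phi>])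
    fix h assume h: "h \<in> model_perp \<theta> \<inter> Linf" "l2_norm h \<le> 1"
    have "C * l2_norm h \<le> \<bar>C\<bar> * 1" using h(2) by (intro mult_mono) auto
    with C[OF h(1)] show "l2_norm (dual_trunc_hankel \<theta> \<phi> h) \<le> \<bar>C\<bar>" by simp
  qed simp
  then show "\<phi> \<in> Linf" by (rule LinfI[OF L2_measurable[OF \<phi>]])
next
  assume "\<phi> \<in> Linf"
  then show "bounded_op (model_perp \<theta> \<inter> Linf) (dual_trunc_hankel \<theta> \<phi>)"
    unfolding bounded_op_def using hankel_norm_le_linf[OF \<theta>] model_perp_L2[of \<theta>] by blast
qed

text \<open>
  The lower bound uses bounded test functions only, and the upper bound holds on all of \<open>L\<^sup>2\<close>, so
  the norm is the same on every domain between the two.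
\<close>

lemma hankel_op_norm:
  assumes \<theta>: "inner_function \<theta>" and \<phi>: "\<phi> \<in> L2" "\<phi> \<in> Linf"
    and D: "model_perp \<theta> \<inter> Linf \<subseteq> D" "D \<subseteq> L2"
  shows "op_norm D (dual_trunc_hankel \<theta> \<phi>) = linf_norm \<phi>"
proof (rule antisym)
  let ?T = "dual_trunc_hankel \<theta> \<phi>"
  have fin: "linf_norm \<phi> < \<infinity>" using \<phi>(2) by (simp add: Linf_def)
  show le: "op_norm D ?T \<le> linf_norm \<phi>"
    unfolding op_norm_def
  proof (rule SUP_least)
    fix h assume "h \<in> {h \<in> D. l2_norm h \<le> 1}"
    then have h: "h \<in> L2" "l2_norm h \<le> 1" using D by auto
    have "l2_norm (?T h) \<le> enn2real (linf_norm \<phi>) * 1"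
      using hankel_norm_le_linf[OF \<theta> \<phi>(2) h(1)] mult_left_mono[OF h(2) enn2real_nonneg[of "linf_norm \<phi>"]]
      by linarith
    then have "ennreal (l2_norm (?T h)) \<le> ennreal (enn2real (linf_norm \<phi>))" by (intro ennreal_leI) simp
    also have "\<dots> = linf_norm \<phi>" using fin by simp
    finally show "ennreal (l2_norm (?T h)) \<le> linf_norm \<phi>" .
  qed
  have fin': "op_norm D ?T < \<infinity>" using le fin by (rule le_less_trans)
  have "AE z in circle. cmod (\<phi> z) \<le> enn2real (op_norm D ?T)"
  proof (rule hankel_bound_AE[OF \<theta> \<phi>(1)])
    fix h assume "h \<in> model_perp \<theta> \<inter> Linf" "l2_norm h \<le> 1"
    then have "ennreal (l2_norm (?T h)) \<le> op_norm D ?T"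
      unfolding op_norm_def using D by (intro SUP_upper) auto
    from enn2real_mono[OF this] fin' show "l2_norm (?T h) \<le> enn2real (op_norm D ?T)" by simp
  qed simp
  from linf_norm_le[OF L2_measurable[OF \<phi>(1)] this] fin'
  show "linf_norm \<phi> \<le> op_norm D ?T" by simp
qed

text \<open>
  The test functions are now \<open>cnj z ^ n\<close>. Their images stay close to the functions \<open>z\<^sup>n G\<close>, with \<open>G\<close> the flip of
  \<open>\<phi>\<close>, which tend to zero weakly and all have the norm of \<open>\<phi>\<close>. A strongly convergent subsequence
  can only exist when this norm is zero.
\<close>

lemma hankel_compact_imp_symbol_zero:
  assumes \<theta>: "inner_function \<theta>" and \<phi>: "\<phi> \<in> L2" and D: "model_perp \<theta> \<inter> Linf \<subseteq> D"
    and compact: "compact_op D (dual_trunc_hankel \<theta> \<phi>)"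
  shows "AE z in circle. \<phi> z = 0"
proof -
  let ?T = "dual_trunc_hankel \<theta> \<phi>" and ?G = "flip \<phi>"
  let ?c = "\<lambda>n z. cnj z ^ n * 1"
  have G: "?G \<in> L2" by (rule L2_flip[OF \<phi>])
  have err: "(\<lambda>n. l2_norm (\<lambda>z. z ^ n * ?G z - ?T (?c n) z)) \<longlonglongrightarrow> 0"
    using hankel_shift[OF \<theta>, of \<phi> "\<lambda>_. 1"] \<phi> by simp
  obtain N where N: "\<And>n. n \<ge> N \<Longrightarrow> ?c n \<in> model_perp \<theta> \<inter> Linf"
    using test_function_domain[OF trig_const, of 1 \<theta>] unfolding eventually_sequentially by blast
  have T: "?T (?c n) \<in> L2" for n
  proof (rule hankel_L2[OF \<theta>])
    have "AE z in circle. cmod (cnj z ^ n) \<le> 1"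
      using AE_circle_cnj_power_norm[of n] by eventually_elim simp
    then show "(\<lambda>z. \<phi> z * (cnj z ^ n * 1)) \<in> L2"
      using L2_mult_bounded[OF \<phi>, of "\<lambda>z. cnj z ^ n" 1] by (simp add: mult.commute)
  qed
  have "l2_norm (?c n) = l2_norm (\<lambda>z. 1)" for n
    by (rule l2_norm_mult_unimodular) (use AE_circle_cnj_power_norm in auto)
  then have "\<exists>C. \<forall>n. l2_norm (?c (N + n)) \<le> C" by auto
  moreover have "\<forall>n. ?c (N + n) \<in> D" using N D by auto
  ultimately obtain g r where g: "g \<in> L2" and r: "strict_mono r"
    and lim: "(\<lambda>n. l2_norm (\<lambda>z. ?T (?c (N + r n)) z - g z)) \<longlonglongrightarrow> 0"
    using compact[unfolded compact_op_def, rule_format, of "\<lambda>n. ?c (N + n)"] by blast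
  define s where "s n = N + r n" for n
  have s: "strict_mono s" using r by (auto simp: s_def strict_mono_def)
  have conv: "(\<lambda>n. l2_norm (\<lambda>z. z ^ s n * ?G z - g z)) \<longlonglongrightarrow> 0"
  proof (rule Lim_null_comparison)
    show "\<forall>\<^sub>F n in sequentially. norm (l2_norm (\<lambda>z. z ^ s n * ?G z - g z)) \<le>
        l2_norm (\<lambda>z. z ^ s n * ?G z - ?T (?c (s n)) z) + l2_norm (\<lambda>z. ?T (?c (s n)) z - g z)"
      using l2_norm_triangle_diff[OF L2_shift[OF G] T g] by simp
    show "(\<lambda>n. l2_norm (\<lambda>z. z ^ s n * ?G z - ?T (?c (s n)) z) + l2_norm (\<lambda>z. ?T (?c (s n)) z - g z)) \<longlonglongrightarrow> 0"
      using tendsto_add[OF LIMSEQ_subseq_LIMSEQ[OF err s] lim] by (simp add: o_def s_def)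
  qed
  have "l2_inner g v = 0" if v: "v \<in> trig" for v
  proof (rule LIMSEQ_unique)
    show "(\<lambda>n. l2_inner (\<lambda>z. z ^ s n * ?G z) v) \<longlonglongrightarrow> l2_inner g v"
      by (rule l2_inner_tendsto[OF L2_shift[OF G] g trig_L2[OF v] conv])
    show "(\<lambda>n. l2_inner (\<lambda>z. z ^ s n * ?G z) v) \<longlonglongrightarrow> 0"
      using LIMSEQ_subseq_LIMSEQ[OF shift_weakly_null[OF G v] s] by (simp add: o_def)
  qed
  then have "AE z in circle. g z = 0"
    using g by (intro AE_zero_if_orth_trig) (simp add: l2_orth_def)
  then have "l2_norm g = 0" using l2_norm_eq_0_iff[OF g] by simp
  then have "l2_norm \<phi> \<le> l2_norm (\<lambda>z. z ^ s n * ?G z - g z)" for n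
    using l2_norm_triangle_sub[OF L2_shift[OF G] g, of "s n"] l2_norm_shift[OF G, of "s n"]
      l2_norm_flip[OF L2_measurable[OF \<phi>]] by simp
  then have "l2_norm \<phi> \<le> 0" using conv by (intro LIMSEQ_le_const) auto
  then have "l2_norm \<phi> = 0" using l2_norm_nonneg[of \<phi>] by linarith
  then show ?thesis using l2_norm_eq_0_iff[OF \<phi>] by simp
qed

lemma hankel_compact_iff_zero:
  assumes \<theta>: "inner_function \<theta>" and \<phi>: "\<phi> \<in> L2" and D: "model_perp \<theta> \<inter> Linf \<subseteq> D"
    and \<phi>D: "\<And>h. h \<in> D \<Longrightarrow> (\<lambda>z. \<phi> z * h z) \<in> L2"
  shows "compact_op D (dual_trunc_hankel \<theta> \<phi>) \<longleftrightarrow> zero_op D (dual_trunc_hankel \<theta> \<phi>)"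
proof
  assume "compact_op D (dual_trunc_hankel \<theta> \<phi>)"
  from hankel_compact_imp_symbol_zero[OF \<theta> \<phi> D this]
  have zero: "AE z in circle. \<phi> z = 0" .
  show "zero_op D (dual_trunc_hankel \<theta> \<phi>)"
    unfolding zero_op_def
  proof
    fix h assume h: "h \<in> D"
    have "AE z in circle. \<phi> z * h z = 0" using zero by eventually_elim simp
    then have "l2_norm (\<lambda>z. \<phi> z * h z) = 0" using l2_norm_eq_0_iff[OF \<phi>D[OF h]] by simp
    then have "l2_norm (dual_trunc_hankel \<theta> \<phi> h) = 0"
      using hankel_norm_le[OF \<theta> \<phi>D[OF h]] l2_norm_nonneg[of "dual_trunc_hankel \<theta> \<phi> h"] by linarith
    then show "AE z in circle. dual_trunc_hankel \<theta> \<phi> h z = 0"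
      using l2_norm_eq_0_iff[OF hankel_L2[OF \<theta> \<phi>D[OF h]]] by simp
  qed
next
  assume zero: "zero_op D (dual_trunc_hankel \<theta> \<phi>)"
  show "compact_op D (dual_trunc_hankel \<theta> \<phi>)"
    unfolding compact_op_def
  proof (intro allI impI)
    fix h :: "nat \<Rightarrow> complex \<Rightarrow> complex"
    assume "(\<forall>n. h n \<in> D) \<and> (\<exists>C. \<forall>n. l2_norm (h n) \<le> C)"
    then have h: "h n \<in> D" for n by blast
    have "l2_norm (\<lambda>z. dual_trunc_hankel \<theta> \<phi> (h n) z - 0) = 0" for n
      using zero h[of n] l2_norm_eq_0_iff[OF hankel_L2[OF \<theta> \<phi>D[OF h[of n]]]] by (simp add: zero_op_def)
    then show "\<exists>g\<in>L2. \<exists>r. strict_mono r \<and>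
        (\<lambda>n. l2_norm (\<lambda>z. dual_trunc_hankel \<theta> \<phi> (h (r n)) z - g z)) \<longlonglongrightarrow> 0"
      by (intro bexI[OF _ L2_zero] exI[of _ id]) (simp add: strict_mono_id)
  qed
qed

theorem theorem4p2:
  fixes \<theta> \<phi> :: "complex \<Rightarrow> complex"
  assumes "inner_function \<theta>" and "\<phi> \<in> L2"
  shows
    "l2_dense_in (model_perp \<theta> \<inter> Linf) (model_perp \<theta>) \<and>
     (bounded_op (model_perp \<theta> \<inter> Linf) (dual_trunc_hankel \<theta> \<phi>) \<longleftrightarrow> \<phi> \<in> Linf) \<and>
     (\<phi> \<in> Linf \<longrightarrow>
        op_norm (model_perp \<theta> \<inter> Linf) (dual_trunc_hankel \<theta> \<phi>) = linf_norm \<phi> \<and>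
        op_norm (model_perp \<theta>) (dual_trunc_hankel \<theta> \<phi>) = linf_norm \<phi>) \<and>
     (compact_op (model_perp \<theta> \<inter> Linf) (dual_trunc_hankel \<theta> \<phi>) \<longleftrightarrow>
        zero_op (model_perp \<theta> \<inter> Linf) (dual_trunc_hankel \<theta> \<phi>)) \<and>
     (\<phi> \<in> Linf \<longrightarrow>
        (compact_op (model_perp \<theta>) (dual_trunc_hankel \<theta> \<phi>) \<longleftrightarrow>
         zero_op (model_perp \<theta>) (dual_trunc_hankel \<theta> \<phi>)))"
proof (intro conjI impI)
  note D = model_perp_L2[of \<theta>]
  show "l2_dense_in (model_perp \<theta> \<inter> Linf) (model_perp \<theta>)"
    by (rule bounded_model_perp_dense[OF assms(1)])
  show "bounded_op (model_perp \<theta> \<inter> Linf) (dual_trunc_hankel \<theta> \<phi>) \<longleftrightarrow> \<phi> \<in> Linf"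
    by (rule hankel_bounded_iff[OF assms])
  show "op_norm (model_perp \<theta> \<inter> Linf) (dual_trunc_hankel \<theta> \<phi>) = linf_norm \<phi>"
    and "op_norm (model_perp \<theta>) (dual_trunc_hankel \<theta> \<phi>) = linf_norm \<phi>" if "\<phi> \<in> Linf"
    using D by (auto intro!: hankel_op_norm[OF assms that])
  have "(\<lambda>z. \<phi> z * h z) \<in> L2" if "h \<in> Linf" for h
    using L2_mult_Linf[OF that assms(2)] by (simp add: mult.commute)
  then show "compact_op (model_perp \<theta> \<inter> Linf) (dual_trunc_hankel \<theta> \<phi>) \<longleftrightarrow>
      zero_op (model_perp \<theta> \<inter> Linf) (dual_trunc_hankel \<theta> \<phi>)"
    by (intro hankel_compact_iff_zero[OF assms]) auto
  show "compact_op (model_perp \<theta>) (dual_trunc_hankel \<theta> \<phi>) \<longleftrightarrow>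
      zero_op (model_perp \<theta>) (dual_trunc_hankel \<theta> \<phi>)" if "\<phi> \<in> Linf"
    using D by (intro hankel_compact_iff_zero[OF assms] L2_mult_Linf[OF that]) auto
qed

end
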